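(* Let $Y$ be a nonsingular real algebraic variety, each point of which has a Zariski open neighborhood that is a malleable variety. Then $Y$ is a malleable variety.
   Context: A real algebraic variety is a ringed space with structure sheaf of $\mathbb{R}$-algebras of $\mathbb{R}$-valued functions which is isomorphic to a Zariski locally closed subset of some real projective space $\mathbb{P}^n(\mathbb{R})$, with the Zariski topology and the sheaf of regular functions; each such variety is affine, i.e. isomorphic to an algebraic subset of some $\mathbb{R}^n$. Morphisms are called regular maps: for algebraic sets $X\subset\mathbb{R}^n$, $Y\subset\mathbb{R}^p$ and $U\subset X$ Zariski open, a function $U\to\mathbb{R}$ is regular iff it equals $P/Q$ on $U$ for polynomials $P,Q$ with $Q$ nowhere zero on $U$, and a map $U\to Y$ is regular iff its components are. Vector bundles are real; algebraic vector bundles over $Y$ are those algebraically isomorphic to algebraic subbundles of product bundles $Y\times\mathbb{R}^n$ (Bochnak–Coste–Roy). For a vector bundle $p:E\to Y$, $E_y=p^{-1}(y)$ and $0_y$ is the zero vector of $E_y$. Let $Y$ be a nonsingular real algebraic variety. A spray $(E,p,s)$ for $Y$ consists of an algebraic vector bundle $p:E\to Y$ and a regular map $s:E\to Y$ such that $s(0_y)=y$ for all $y\in Y$. It is dominating if for every $y\in Y$ the map $E_y\to Y$, $v\mapsto s(v)$ is a submersion at $0_y$. $Y$ is malleable if it admits a dominating spray. (A Zariski open subset of $Y$ is itself a nonsingular real algebraic variety.) *)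

theory Defs
  imports "HOL-Analysis.Analysis"
begin

text \<open>
  Spaces with a sheaf of real-valued functions. A section over an open set \<open>U\<close> is represented by a
  total function, whose values outside \<open>U\<close> are irrelevant.
\<close>

record 'a ringed_space =
  zariski :: "'a topology"
  regular :: "'a set \<Rightarrow> ('a \<Rightarrow> real) set"

abbreviation points :: "('a, 'm) ringed_space_scheme \<Rightarrow> 'a set" where
  "points X \<equiv> topspace (zariski X)"

text \<open>Morphisms are continuous maps that pull sections back to sections.\<close>

definition regular_map :: "'a ringed_space \<Rightarrow> 'b ringed_space \<Rightarrow> ('a \<Rightarrow> 'b) \<Rightarrow> bool" where
  "regular_map X Z \<phi> \<longleftrightarrow>
     continuous_map (zariski X) (zariski Z) \<phi> \<and>
     (\<forall>V g. openin (zariski Z) V \<longrightarrow> g \<in> regular Z V \<longrightarrow>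
        g \<circ> \<phi> \<in> regular X {x \<in> points X. \<phi> x \<in> V})"

text \<open>
  Isomorphisms: homeomorphisms that identify the two sheaves. The equivalence is required for all
  functions \<open>f\<close>, so that a space isomorphic to one whose sections over \<open>U\<close> only depend on
  their values on \<open>U\<close> has this property as well.
\<close>

definition ringed_iso :: "'a ringed_space \<Rightarrow> 'b ringed_space \<Rightarrow> ('a \<Rightarrow> 'b) \<Rightarrow> bool" where
  "ringed_iso X Z \<phi> \<longleftrightarrow>
     (\<exists>\<psi>. homeomorphic_maps (zariski X) (zariski Z) \<phi> \<psi> \<and>
       (\<forall>U f. openin (zariski X) U \<longrightarrow>
          (f \<in> regular X U \<longleftrightarrow> f \<circ> \<psi> \<in> regular Z (\<phi> ` U))))"

text \<open>
  The structure induced on an arbitrary subset \<open>S\<close>: sections are the functions that locally are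
  restrictions of sections of \<open>X\<close>. It yields the open and the closed subvarieties.
\<close>

definition induced_space :: "'a ringed_space \<Rightarrow> 'a set \<Rightarrow> 'a ringed_space" where
  "induced_space X S =
     \<lparr> zariski = subtopology (zariski X) S,
       regular = (\<lambda>V. {f. \<forall>x\<in>V. \<exists>W g. openin (zariski X) W \<and> x \<in> W \<and> g \<in> regular X W \<and>
                              (\<forall>z\<in>W \<inter> V. f z = g z)}) \<rparr>"

inductive_set generated_algebra :: "('a \<Rightarrow> real) set \<Rightarrow> ('a \<Rightarrow> real) set"
  for G :: "('a \<Rightarrow> real) set" where
  generator: "g \<in> G \<Longrightarrow> g \<in> generated_algebra G"
| const: "(\<lambda>_. c) \<in> generated_algebra G"
| add: "f \<in> generated_algebra G \<Longrightarrow> g \<in> generated_algebra G \<Longrightarrow> (\<lambda>x. f x + g x) \<in> generated_algebra G"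
| mult: "f \<in> generated_algebra G \<Longrightarrow> g \<in> generated_algebra G \<Longrightarrow> (\<lambda>x. f x * g x) \<in> generated_algebra G"

text \<open>The vector space \<open>\<real>\<^sup>n\<close>, realised by the sequences that vanish from index \<open>n\<close> on.\<close>

definition Rn :: "nat \<Rightarrow> (nat \<Rightarrow> real) set" where
  "Rn n = {x. \<forall>i\<ge>n. x i = 0}"

definition polynomials :: "nat \<Rightarrow> ((nat \<Rightarrow> real) \<Rightarrow> real) set" where
  "polynomials n = generated_algebra {(\<lambda>x. x i) |i. i < n}"

text \<open>
  Over \<open>\<real>\<close>, a polynomial is homogeneous of degree \<open>d\<close> if and only if the associated function is.
\<close>

definition homogeneous :: "nat \<Rightarrow> nat \<Rightarrow> ((nat \<Rightarrow> real) \<Rightarrow> real) set" where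
  "homogeneous n d = {P \<in> polynomials n. \<forall>t. \<forall>x\<in>Rn n. P (\<lambda>i. t * x i) = t ^ d * P x}"

text \<open>
  A point of \<open>\<P>\<^sup>n(\<real>)\<close> is the set of its homogeneous coordinate vectors. The nonvanishing loci of
  homogeneous polynomials form a basis of the Zariski topology, since they are closed under finite
  intersections (take products).
\<close>

definition proj_point :: "(nat \<Rightarrow> real) \<Rightarrow> (nat \<Rightarrow> real) set" where
  "proj_point x = {(\<lambda>i. t * x i) |t. t \<noteq> 0}"

definition proj_points :: "nat \<Rightarrow> (nat \<Rightarrow> real) set set" where
  "proj_points n = proj_point ` (Rn (Suc n) - {\<lambda>_. 0})"

definition proj_zariski :: "nat \<Rightarrow> (nat \<Rightarrow> real) set topology" where
  "proj_zariski n =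
     topology_generated_by
       {{l \<in> proj_points n. \<forall>x\<in>l. F x \<noteq> 0} |F d. F \<in> homogeneous (Suc n) d}"

definition proj_space :: "nat \<Rightarrow> (nat \<Rightarrow> real) set ringed_space" where
  "proj_space n =
     \<lparr> zariski = proj_zariski n,
       regular = (\<lambda>U. {f. \<forall>l\<in>U. \<exists>W d P Q. openin (proj_zariski n) W \<and> l \<in> W \<and>
                     P \<in> homogeneous (Suc n) d \<and> Q \<in> homogeneous (Suc n) d \<and>
                     (\<forall>m\<in>W \<inter> U. \<forall>x\<in>m. Q x \<noteq> 0 \<and> f m = P x / Q x)}) \<rparr>"

definition locally_closed_in :: "'a topology \<Rightarrow> 'a set \<Rightarrow> bool" where
  "locally_closed_in T S \<longleftrightarrow> (\<exists>C U. closedin T C \<and> openin T U \<and> S = C \<inter> U)"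

definition real_algebraic_variety :: "'a ringed_space \<Rightarrow> bool" where
  "real_algebraic_variety X \<longleftrightarrow>
     (\<exists>n S \<phi>. locally_closed_in (zariski (proj_space n)) S \<and>
        ringed_iso X (induced_space (proj_space n) S) \<phi>)"

text \<open>Local rings: sections near \<open>y\<close>, to be compared on neighbourhoods of \<open>y\<close>.\<close>

definition regular_at :: "'a ringed_space \<Rightarrow> 'a \<Rightarrow> ('a \<Rightarrow> real) set" where
  "regular_at X y = {f. \<exists>U. openin (zariski X) U \<and> y \<in> U \<and> f \<in> regular X U}"

definition germ_eq :: "'a ringed_space \<Rightarrow> 'a \<Rightarrow> ('a \<Rightarrow> real) \<Rightarrow> ('a \<Rightarrow> real) \<Rightarrow> bool" where
  "germ_eq X y f g \<longleftrightarrow> (\<exists>U. openin (zariski X) U \<and> y \<in> U \<and> (\<forall>x\<in>U. f x = g x))"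

definition irreducible_closed_in :: "'a topology \<Rightarrow> 'a set \<Rightarrow> bool" where
  "irreducible_closed_in T C \<longleftrightarrow>
     closedin T C \<and> C \<noteq> {} \<and>
     (\<forall>A B. closedin T A \<longrightarrow> closedin T B \<longrightarrow> C = A \<union> B \<longrightarrow> C = A \<or> C = B)"

text \<open>
  The dimension of \<open>X\<close> at \<open>y\<close>, which is the Krull dimension of the local ring at \<open>y\<close>, measured by
  chains of irreducible closed sets through \<open>y\<close>.
\<close>

definition local_dimension :: "'a ringed_space \<Rightarrow> 'a \<Rightarrow> enat" where
  "local_dimension X y =
     Sup {enat d |d. \<exists>C. (\<forall>i\<le>d. irreducible_closed_in (zariski X) (C i) \<and> y \<in> C i) \<and>
                         (\<forall>i<d. C i \<subset> C (Suc i))}"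

text \<open>
  Nonsingular: every local ring is a regular local ring, i.e. its maximal ideal is generated by as
  many elements as its dimension indicates. The dimension may differ from point to point.
\<close>

definition nonsingular :: "'a ringed_space \<Rightarrow> bool" where
  "nonsingular X \<longleftrightarrow>
     (\<forall>y\<in>points X. \<exists>d g. local_dimension X y = enat d \<and>
        (\<forall>i<d. g i \<in> regular_at X y \<and> g i y = 0) \<and>
        (\<forall>f\<in>regular_at X y. f y = 0 \<longrightarrow>
           (\<exists>a. (\<forall>i<d. a i \<in> regular_at X y) \<and>
                germ_eq X y f (\<lambda>x. \<Sum>i<d. a i x * g i x))))"

text \<open>The tangent space at \<open>y\<close> consists of the derivations of the local ring into \<open>\<real>\<close>.\<close>

definition tangent_vector :: "'a ringed_space \<Rightarrow> 'a \<Rightarrow> (('a \<Rightarrow> real) \<Rightarrow> real) \<Rightarrow> bool" where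
  "tangent_vector X y D \<longleftrightarrow>
     (\<forall>f\<in>regular_at X y. \<forall>g\<in>regular_at X y.
        (germ_eq X y f g \<longrightarrow> D f = D g) \<and>
        D (\<lambda>x. f x + g x) = D f + D g \<and>
        D (\<lambda>x. f x * g x) = f y * D g + g y * D f) \<and>
     (\<forall>f\<in>regular_at X y. \<forall>c. D (\<lambda>x. c * f x) = c * D f)"

text \<open>Surjectivity of the differential, which sends \<open>D\<close> to \<open>\<lambda>g. D (g \<circ> \<phi>)\<close>.\<close>

definition submersion_at :: "'a ringed_space \<Rightarrow> 'b ringed_space \<Rightarrow> ('a \<Rightarrow> 'b) \<Rightarrow> 'a \<Rightarrow> bool" where
  "submersion_at X Z \<phi> x \<longleftrightarrow>
     (\<forall>D'. tangent_vector Z (\<phi> x) D' \<longrightarrow>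
        (\<exists>D. tangent_vector X x D \<and> (\<forall>g\<in>regular_at Z (\<phi> x). D' g = D (g \<circ> \<phi>))))"

text \<open>
  The product of a variety \<open>Y\<close> with \<open>\<real>\<^sup>n\<close>. As \<open>Y\<close> is affine, the product is the affine variety
  whose polynomial functions may be taken to be the polynomials in the coordinates of \<open>\<real>\<^sup>n\<close> with
  global regular functions on \<open>Y\<close> as coefficients: closed sets are their zero sets (the
  nonvanishing loci of single elements form a basis of the topology), and regular functions are
  their fractions.
\<close>

definition product_functions :: "'a ringed_space \<Rightarrow> nat \<Rightarrow> ('a \<times> (nat \<Rightarrow> real) \<Rightarrow> real) set" where
  "product_functions Y n =
     generated_algebra
       ({(\<lambda>(y, v). f y) |f. f \<in> regular Y (points Y)} \<union> {(\<lambda>(y, v). v i) |i. i < n})"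

definition product_space :: "'a ringed_space \<Rightarrow> nat \<Rightarrow> ('a \<times> (nat \<Rightarrow> real)) ringed_space" where
  "product_space Y n =
     \<lparr> zariski = topology_generated_by
         {{z \<in> points Y \<times> Rn n. h z \<noteq> 0} |h. h \<in> product_functions Y n},
       regular = (\<lambda>W. {f. \<exists>P\<in>product_functions Y n. \<exists>Q\<in>product_functions Y n.
                              \<forall>z\<in>W. Q z \<noteq> 0 \<and> f z = P z / Q z}) \<rparr>"

record ('e, 'a) vbundle =
  total_space :: "'e ringed_space"
  proj :: "'e \<Rightarrow> 'a"
  vadd :: "'e \<Rightarrow> 'e \<Rightarrow> 'e"
  vscale :: "real \<Rightarrow> 'e \<Rightarrow> 'e"
  vzero :: "'a \<Rightarrow> 'e"

definition fibre :: "('e, 'a) vbundle \<Rightarrow> 'a \<Rightarrow> 'e set" where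
  "fibre B y = {e \<in> points (total_space B). proj B e = y}"

definition real_vector_space_on ::
    "'e set \<Rightarrow> ('e \<Rightarrow> 'e \<Rightarrow> 'e) \<Rightarrow> (real \<Rightarrow> 'e \<Rightarrow> 'e) \<Rightarrow> 'e \<Rightarrow> bool" where
  "real_vector_space_on V pl sm z \<longleftrightarrow>
     z \<in> V \<and>
     (\<forall>u\<in>V. \<forall>v\<in>V. pl u v \<in> V) \<and>
     (\<forall>c. \<forall>u\<in>V. sm c u \<in> V) \<and>
     (\<forall>u\<in>V. \<forall>v\<in>V. \<forall>w\<in>V. pl (pl u v) w = pl u (pl v w)) \<and>
     (\<forall>u\<in>V. \<forall>v\<in>V. pl u v = pl v u) \<and>
     (\<forall>u\<in>V. pl z u = u) \<and>
     (\<forall>u\<in>V. \<exists>v\<in>V. pl u v = z) \<and>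
     (\<forall>c. \<forall>u\<in>V. \<forall>v\<in>V. sm c (pl u v) = pl (sm c u) (sm c v)) \<and>
     (\<forall>c d. \<forall>u\<in>V. sm (c + d) u = pl (sm c u) (sm d u)) \<and>
     (\<forall>c d. \<forall>u\<in>V. sm c (sm d u) = sm (c * d) u) \<and>
     (\<forall>u\<in>V. sm 1 u = u)"

definition vector_space_family :: "'a ringed_space \<Rightarrow> ('e, 'a) vbundle \<Rightarrow> bool" where
  "vector_space_family Y B \<longleftrightarrow>
     regular_map (total_space B) Y (proj B) \<and>
     (\<forall>y\<in>points Y. real_vector_space_on (fibre B y) (vadd B) (vscale B) (vzero B y))"

definition bundle_iso ::
    "'a ringed_space \<Rightarrow> ('e, 'a) vbundle \<Rightarrow> ('f, 'a) vbundle \<Rightarrow> ('e \<Rightarrow> 'f) \<Rightarrow> bool" where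
  "bundle_iso Y B B' \<theta> \<longleftrightarrow>
     ringed_iso (total_space B) (total_space B') \<theta> \<and>
     (\<forall>e\<in>points (total_space B). proj B' (\<theta> e) = proj B e) \<and>
     (\<forall>y\<in>points Y. \<forall>u\<in>fibre B y. \<forall>v\<in>fibre B y. \<theta> (vadd B u v) = vadd B' (\<theta> u) (\<theta> v)) \<and>
     (\<forall>y\<in>points Y. \<forall>u\<in>fibre B y. \<forall>c. \<theta> (vscale B c u) = vscale B' c (\<theta> u))"

text \<open>A subset \<open>E\<close> of \<open>Y \<times> \<real>\<^sup>n\<close> with the induced structure and the linear operations of \<open>\<real>\<^sup>n\<close>.\<close>

definition sub_bundle ::
    "'a ringed_space \<Rightarrow> nat \<Rightarrow> ('a \<times> (nat \<Rightarrow> real)) set \<Rightarrow> ('a \<times> (nat \<Rightarrow> real), 'a) vbundle" where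
  "sub_bundle Y n E =
     \<lparr> total_space = induced_space (product_space Y n) E,
       proj = fst,
       vadd = (\<lambda>(y, u) (_, v). (y, \<lambda>i. u i + v i)),
       vscale = (\<lambda>c (y, u). (y, \<lambda>i. c * u i)),
       vzero = (\<lambda>y. (y, \<lambda>_. 0)) \<rparr>"

abbreviation product_bundle :: "'a ringed_space \<Rightarrow> nat \<Rightarrow> ('a \<times> (nat \<Rightarrow> real), 'a) vbundle" where
  "product_bundle Y n \<equiv> sub_bundle Y n (points Y \<times> Rn n)"

text \<open>
  Algebraic subbundles of \<open>Y \<times> \<real>\<^sup>n\<close>: families of linear subspaces that are locally trivial in the
  Zariski topology. The rank may vary.
\<close>

definition algebraic_subbundle :: "'a ringed_space \<Rightarrow> nat \<Rightarrow> ('a \<times> (nat \<Rightarrow> real)) set \<Rightarrow> bool" where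
  "algebraic_subbundle Y n E \<longleftrightarrow>
     E \<subseteq> points Y \<times> Rn n \<and>
     vector_space_family Y (sub_bundle Y n E) \<and>
     (\<forall>y\<in>points Y. \<exists>U k \<theta>. openin (zariski Y) U \<and> y \<in> U \<and>
        bundle_iso (induced_space Y U)
          (product_bundle (induced_space Y U) k)
          (sub_bundle (induced_space Y U) n (E \<inter> (U \<times> Rn n))) \<theta>)"

definition algebraic_vector_bundle :: "'a ringed_space \<Rightarrow> ('e, 'a) vbundle \<Rightarrow> bool" where
  "algebraic_vector_bundle Y B \<longleftrightarrow>
     vector_space_family Y B \<and>
     (\<exists>n E \<theta>. algebraic_subbundle Y n E \<and> bundle_iso Y B (sub_bundle Y n E) \<theta>)"

definition spray :: "'a ringed_space \<Rightarrow> ('e, 'a) vbundle \<Rightarrow> ('e \<Rightarrow> 'a) \<Rightarrow> bool" where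
  "spray Y B s \<longleftrightarrow>
     algebraic_vector_bundle Y B \<and>
     regular_map (total_space B) Y s \<and>
     (\<forall>y\<in>points Y. s (vzero B y) = y)"

definition dominating :: "'a ringed_space \<Rightarrow> ('e, 'a) vbundle \<Rightarrow> ('e \<Rightarrow> 'a) \<Rightarrow> bool" where
  "dominating Y B s \<longleftrightarrow>
     (\<forall>y\<in>points Y. submersion_at (induced_space (total_space B) (fibre B y)) Y s (vzero B y))"

text \<open>
  An existential quantifier cannot range over types, so the total space is taken in the type
  \<open>'a \<times> (nat \<Rightarrow> real)\<close>. Nothing is lost, as every algebraic vector bundle over \<open>Y\<close> is isomorphic to
  one with total space in \<open>Y \<times> \<real>\<^sup>n\<close>.
\<close>

definition malleable :: "'a ringed_space \<Rightarrow> bool" where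
  "malleable Y \<longleftrightarrow>
     (\<exists>(B :: ('a \<times> (nat \<Rightarrow> real), 'a) vbundle) s. spray Y B s \<and> dominating Y B s)"

end

theory Submission
  imports Defs "HOL-Computational_Algebra.Polynomial" "HOL-Library.Function_Algebras"
begin

text \<open>
  A dominating spray on an open subset \<open>W\<close> of \<open>Y\<close> can be extended to all of \<open>Y\<close> after rescaling the fibres:
  on \<open>W \<times> \<real>\<^sup>k\<close> the spray \<open>\<sigma>\<close> is given by fractions whose denominators may degenerate at the boundary of
  \<open>W\<close>, but \<open>\<sigma> (y, \<rho> y v)\<close> extends regularly by \<open>y\<close> for a suitable polynomial \<open>\<rho>\<close> that vanishes exactly off
  \<open>W\<close> (\<open>spray_over_extend\<close>). The extension still dominates on \<open>W\<close>. Given two sprays over \<open>Y\<close>, the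
  composite \<open>s2 (s1 (y, u), v)\<close> dominates wherever one of them does (\<open>spray_over_compose\<close>). As the
  Zariski topology is noetherian, finitely many local sprays suffice to dominate everywhere
  (\<open>global_spray\<close>).

  The bundles are arranged to be trivial throughout. A spray on an open subvariety is restricted to a
  smaller open set over which its bundle is trivial, where it is regarded as a family of maps into
  \<open>Y\<close> (\<open>local_spray\<close>); and the final spray lives on a product bundle over \<open>Y\<close>
  (\<open>malleable_if_global_spray\<close>).

  To compute, everything is expressed in coordinates (\<open>affine_coordinates\<close>). Real projective space is
  affine via \<open>u \<mapsto> u u\<^sup>T / |u|\<^sup>2\<close> (\<open>affine_coordinates_proj\<close>), and affine coordinates pass to subsets,
  isomorphic spaces and products with \<open>\<real>\<^sup>n\<close>. Tangent vectors, defined as derivations, are compared with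
  velocities of curves (\<open>regular_curve_derivative\<close>), which reduces domination to derivatives of
  functions of one real variable.
\<close>

section \<open>Noetherian rings of polynomial functions\<close>

text \<open>
  Ideals are formed inside a subring \<open>A\<close> of one fixed type. For every \<open>n\<close> the polynomial functions in \<open>n\<close>
  variables are such a subring of the ring of all functions of a sequence, so that induction on the
  number of variables stays within a single type.
\<close>

inductive_set ideal_span :: "'r::comm_ring_1 set \<Rightarrow> 'r set \<Rightarrow> 'r set" for A T where
  zero: "0 \<in> ideal_span A T"
| step: "a \<in> A \<Longrightarrow> t \<in> T \<Longrightarrow> s \<in> ideal_span A T \<Longrightarrow> a * t + s \<in> ideal_span A T"

definition subring :: "'r::comm_ring_1 set \<Rightarrow> bool" where
  "subring A \<longleftrightarrow> 0 \<in> A \<and> 1 \<in> A \<and> -1 \<in> A \<and> (\<forall>a\<in>A. \<forall>b\<in>A. a + b \<in> A \<and> a * b \<in> A)"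

text \<open>
  The condition on sequences is equivalent to the ascending chain condition, and it is the form that
  contradicts a sequence chosen greedily outside the ideal of its predecessors.
\<close>

definition noetherian :: "'r::comm_ring_1 set \<Rightarrow> bool" where
  "noetherian A \<longleftrightarrow> (\<forall>f::nat \<Rightarrow> 'r. range f \<subseteq> A \<longrightarrow> (\<exists>n. f n \<in> ideal_span A (f ` {..<n})))"

lemma ideal_span_add:
  assumes "p \<in> ideal_span A T" "q \<in> ideal_span A T"
  shows "p + q \<in> ideal_span A T"
  using assms by (induction rule: ideal_span.induct) (auto simp: add.assoc intro: ideal_span.step)

lemma ideal_span_mult:
  assumes "subring A" "p \<in> ideal_span A T" "a \<in> A"
  shows "a * p \<in> ideal_span A T"
  using assms(2)
proof (induction rule: ideal_span.induct)
  case (step b t s)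
  have "a * b \<in> A"
    using assms step by (auto simp: subring_def)
  from ideal_span.step[OF this step(2) step(4)] show ?case
    by (simp add: algebra_simps)
qed (simp add: ideal_span.zero)

lemma ideal_span_diff:
  assumes "subring A" "p \<in> ideal_span A T" "q \<in> ideal_span A T"
  shows "p - q \<in> ideal_span A T"
  using ideal_span_add[OF assms(2) ideal_span_mult[OF assms(1,3), of "-1"]] assms(1)
  by (simp add: subring_def)

lemma ideal_span_base: "subring A \<Longrightarrow> t \<in> T \<Longrightarrow> t \<in> ideal_span A T"
  using ideal_span.step[of 1 A t T 0] by (auto simp: subring_def ideal_span.zero)

lemma ideal_span_least:
  assumes "subring A" "T \<subseteq> ideal_span A T'"
  shows "ideal_span A T \<subseteq> ideal_span A T'"
proof
  fix p assume "p \<in> ideal_span A T"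
  then show "p \<in> ideal_span A T'"
    by (induction rule: ideal_span.induct)
       (use assms in \<open>auto intro: ideal_span.zero ideal_span_add ideal_span_mult\<close>)
qed

lemma ideal_span_mono: "subring A \<Longrightarrow> T \<subseteq> T' \<Longrightarrow> ideal_span A T \<subseteq> ideal_span A T'"
  by (rule ideal_span_least) (auto intro: ideal_span_base)

text \<open>
  An element of the span involves only finitely many generators.
\<close>

lemma ideal_span_directed:
  assumes A: "subring A" and "p \<in> ideal_span A (range f)"
  shows "\<exists>m::nat. p \<in> ideal_span A (f ` {..<m})"
  using assms(2)
proof (induction rule: ideal_span.induct)
  case (step a t s)
  then obtain m i where m: "s \<in> ideal_span A (f ` {..<m})" and i: "t = f i"
    by auto
  let ?T = "f ` {..<max m (Suc i)}"
  have "s \<in> ideal_span A ?T"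
    using ideal_span_mono[OF A, of "f ` {..<m}" ?T] m by fastforce
  moreover have "t \<in> ?T"
    using i by auto
  ultimately show ?case
    using step(1) by (blast intro: ideal_span.step)
qed (blast intro: ideal_span.zero)

definition polys_over :: "'r::comm_ring_1 set \<Rightarrow> 'r poly set" where
  "polys_over A = {p. \<forall>i. coeff p i \<in> A}"

lemma subring_sum: "subring A \<Longrightarrow> (\<And>i. i \<in> I \<Longrightarrow> f i \<in> A) \<Longrightarrow> sum f I \<in> A"
  by (induction I rule: infinite_finite_induct) (auto simp: subring_def)

lemma subring_polys_over: "subring A \<Longrightarrow> subring (polys_over A)"
  unfolding subring_def[of "polys_over A"] polys_over_def
  by (auto simp: coeff_mult subring_def intro!: subring_sum)

lemma greedy_sequence:
  assumes "\<And>S. finite S \<Longrightarrow> S \<subseteq> I \<Longrightarrow> \<exists>r\<in>I. P S r"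
  shows "\<exists>f :: nat \<Rightarrow> 'b. \<forall>n. f n \<in> I \<and> P (f ` {..<n}) (f n)"
proof -
  let ?P = "\<lambda>f (n::nat) r. r \<in> I \<and> P (f ` {..<n}) r"
  show ?thesis
  proof (rule dependent_wellorder_choice[of ?P])
    fix r :: 'b and f g :: "nat \<Rightarrow> 'b" and n :: nat
    assume "\<And>k. k < n \<Longrightarrow> f k = g k"
    then have "f ` {..<n} = g ` {..<n}"
      by auto
    then show "?P f n r = ?P g n r"
      by simp
  next
    fix n :: nat and f :: "nat \<Rightarrow> 'b"
    assume "\<And>k. k < n \<Longrightarrow> ?P f k (f k)"
    then have "f ` {..<n} \<subseteq> I"
      by auto
    then show "\<exists>r. ?P f n r"
      using assms[of "f ` {..<n}"] by blast
  qed
qed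

text \<open>
  Hilbert's argument. From a sequence violating the condition one builds a sequence \<open>g\<close> in the ideal
  generated by it, where \<open>g n\<close> has least degree outside the span of its predecessors. As \<open>A\<close> is
  noetherian, some leading coefficient is a combination of the earlier ones; the corresponding
  combination of the earlier \<open>g i\<close>, shifted to the right degree, cancels the leading term of \<open>g n\<close> and
  contradicts the minimality of its degree.
\<close>

lemma noetherian_polys_over:
  assumes A: "subring A" and noeth: "noetherian A"
  shows "noetherian (polys_over A)"
  unfolding noetherian_def
proof (intro allI impI, rule ccontr)
  fix p :: "nat \<Rightarrow> 'a poly"
  let ?B = "polys_over A"
  assume p: "range p \<subseteq> ?B" and "\<nexists>n. p n \<in> ideal_span ?B (p ` {..<n})"
  then have bad: "p n \<notin> ideal_span ?B (p ` {..<n})" for n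
    by blast
  have B: "subring ?B"
    by (rule subring_polys_over[OF A])
  define I where "I = ideal_span ?B (range p)"
  have I_B: "q \<in> ?B" if "q \<in> I" for q
    using that unfolding I_def
    by (induction rule: ideal_span.induct) (use B p in \<open>auto simp: subring_def\<close>)
  have not_generated: "\<exists>q. q \<in> I \<and> q \<notin> ideal_span ?B G" if G: "finite G" "G \<subseteq> I" for G
  proof -
    have "\<exists>m. G \<subseteq> ideal_span ?B (p ` {..<m})"
      using G
    proof (induction rule: finite_induct)
      case (insert g G)
      then obtain m where m: "G \<subseteq> ideal_span ?B (p ` {..<m})"
        by auto
      from insert obtain m' where m': "g \<in> ideal_span ?B (p ` {..<m'})"
        using ideal_span_directed[OF B, of g p] by (auto simp: I_def)
      have "ideal_span ?B (p ` {..<m}) \<subseteq> ideal_span ?B (p ` {..<max m m'})"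
        "ideal_span ?B (p ` {..<m'}) \<subseteq> ideal_span ?B (p ` {..<max m m'})"
        by (intro ideal_span_mono[OF B] image_mono; force)+
      then show ?case
        using m m' by blast
    qed auto
    then obtain m where "ideal_span ?B G \<subseteq> ideal_span ?B (p ` {..<m})"
      using ideal_span_least[OF B] by blast
    then have "p m \<notin> ideal_span ?B G"
      using bad by blast
    moreover have "p m \<in> I"
      unfolding I_def by (rule ideal_span_base[OF B]) simp
    ultimately show ?thesis
      by blast
  qed
  define fresh where "fresh G q \<longleftrightarrow> q \<notin> ideal_span ?B G \<and>
      (\<forall>r. r \<in> I \<and> r \<notin> ideal_span ?B G \<longrightarrow> degree q \<le> degree r)" for G q
  have "\<exists>q\<in>I. fresh G q" if "finite G" "G \<subseteq> I" for G
    using not_generated[OF that]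
      ex_has_least_nat[of "\<lambda>q. q \<in> I \<and> q \<notin> ideal_span ?B G" _ degree]
    unfolding fresh_def by blast
  from greedy_sequence[of I fresh, OF this]
  obtain g :: "nat \<Rightarrow> 'a poly" where g: "\<forall>n. g n \<in> I \<and> fresh (g ` {..<n}) (g n)" ..
  then have g_I: "\<And>n. g n \<in> I" and g_new: "\<And>n. g n \<notin> ideal_span ?B (g ` {..<n})"
    and g_min: "\<And>n q. q \<in> I \<Longrightarrow> q \<notin> ideal_span ?B (g ` {..<n}) \<Longrightarrow> degree (g n) \<le> degree q"
    unfolding fresh_def by blast+
  have "range (\<lambda>n. lead_coeff (g n)) \<subseteq> A"
    using I_B[OF g_I] by (auto simp: polys_over_def)
  then obtain n where n: "lead_coeff (g n) \<in> ideal_span A ((\<lambda>n. lead_coeff (g n)) ` {..<n})"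
    using noeth[unfolded noetherian_def, rule_format, of "\<lambda>n. lead_coeff (g n)"] by blast
  let ?d = "degree (g n)" and ?S = "ideal_span ?B (g ` {..<n})"
  have degree_le: "degree (g i) \<le> ?d" if "i < n" for i
  proof (rule g_min[OF g_I])
    have "ideal_span ?B (g ` {..<i}) \<subseteq> ?S"
      using that by (intro ideal_span_mono[OF B]) auto
    then show "g n \<notin> ideal_span ?B (g ` {..<i})"
      using g_new by blast
  qed
  \<comment> \<open>combinations of the earlier leading coefficients are coefficients of combinations of the earlier
    polynomials\<close>
  have "\<exists>h\<in>?S. degree h \<le> ?d \<and> coeff h ?d = c"
    if "c \<in> ideal_span A ((\<lambda>n. lead_coeff (g n)) ` {..<n})" for c
    using that
  proof (induction rule: ideal_span.induct)
    case (step a t s)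
    then obtain h i where h: "h \<in> ?S" "degree h \<le> ?d" "coeff h ?d = s"
      and i: "i < n" "t = lead_coeff (g i)"
      by auto
    let ?m = "monom a (?d - degree (g i))"
    have "?m \<in> ?B"
      using A step(1) by (auto simp: polys_over_def subring_def)
    then have "?m * g i + h \<in> ?S"
      using h i by (intro ideal_span.step) auto
    moreover have "degree (?m * g i) \<le> ?d"
      using degree_mult_le[of ?m "g i"] degree_monom_le[of a "?d - degree (g i)"] degree_le[OF i(1)]
      by linarith
    then have "degree (?m * g i + h) \<le> ?d"
      using h by (intro degree_add_le) auto
    moreover have "coeff (?m * g i + h) ?d = a * t + s"
      using h i degree_le[OF i(1)] by (simp add: coeff_monom_mult)
    ultimately show ?case
      by blast
  qed (auto intro!: bexI[of _ 0] ideal_span.zero)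
  with n obtain h where h: "h \<in> ?S" "degree h \<le> ?d" "coeff h ?d = lead_coeff (g n)"
    by blast
  have "?S \<subseteq> I"
    unfolding I_def by (rule ideal_span_least[OF B]) (use g_I in \<open>auto simp: I_def\<close>)
  then have in_I: "g n - h \<in> I"
    using h g_I unfolding I_def by (intro ideal_span_diff[OF B]) auto
  have new: "g n - h \<notin> ?S"
    using ideal_span_add[of "g n - h" ?B "g ` {..<n}" h] h g_new[of n] by auto
  then have "g n - h \<noteq> 0"
    using ideal_span.zero by metis
  moreover have "coeff (g n - h) ?d = 0" "degree (g n - h) \<le> ?d"
    using h by (auto intro: degree_diff_le)
  ultimately have "degree (g n - h) < ?d"
    by (metis le_neq_implies_less leading_coeff_0_iff)
  with g_min[OF in_I new] show False
    by simp
qed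

lemma noetherian_adjoin:
  assumes "subring A" "noetherian A"
  shows "noetherian ((\<lambda>p. poly p t) ` polys_over A)"
  unfolding noetherian_def
proof (intro allI impI)
  fix f :: "nat \<Rightarrow> 'a"
  let ?B = "polys_over A" and ?e = "\<lambda>p. poly p t"
  assume "range f \<subseteq> ?e ` ?B"
  then have "\<forall>n. \<exists>p\<in>?B. f n = ?e p"
    by auto
  then obtain p where p: "\<And>n. p n \<in> ?B" "\<And>n. f n = ?e (p n)"
    by metis
  then obtain n where n: "p n \<in> ideal_span ?B (p ` {..<n})"
    using noetherian_polys_over[OF assms] unfolding noetherian_def by blast
  have "?e q \<in> ideal_span (?e ` ?B) (f ` {..<n})" if "q \<in> ideal_span ?B (p ` {..<n})" for q
    using that
    by (induction rule: ideal_span.induct) (auto simp: p(2) intro!: ideal_span.zero ideal_span.step)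
  with n show "\<exists>n. f n \<in> ideal_span (?e ` ?B) (f ` {..<n})"
    using p(2) by metis
qed

lemma generated_algebra_sum:
  "(\<And>i. i \<in> I \<Longrightarrow> f i \<in> generated_algebra G) \<Longrightarrow> (\<lambda>x. \<Sum>i\<in>I. f i x) \<in> generated_algebra G"
  by (induction I rule: infinite_finite_induct) (auto intro: generated_algebra.intros)

lemma generated_algebra_prod:
  "(\<And>i. i \<in> I \<Longrightarrow> f i \<in> generated_algebra G) \<Longrightarrow> (\<lambda>x. \<Prod>i\<in>I. f i x) \<in> generated_algebra G"
  by (induction I rule: infinite_finite_induct) (auto intro: generated_algebra.intros)

lemma generated_algebra_power:
  "f \<in> generated_algebra G \<Longrightarrow> (\<lambda>x. f x ^ d) \<in> generated_algebra G"
  by (induction d) (auto intro: generated_algebra.intros)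

lemma subring_generated_algebra: "subring (generated_algebra G)"
  unfolding subring_def zero_fun_def one_fun_def plus_fun_def times_fun_def fun_Compl_def
  by (auto intro: generated_algebra.intros)

text \<open>
  A polynomial in \<open>n + 1\<close> variables is a polynomial in the last one whose coefficients are polynomials
  in the others.
\<close>

lemma polynomials_Suc_subset:
  "polynomials (Suc n) \<subseteq> (\<lambda>p. poly p (\<lambda>x. x n)) ` polys_over (polynomials n)" (is "_ \<subseteq> ?R")
proof
  have polys: "subring (polys_over (polynomials n))"
    unfolding polynomials_def by (intro subring_polys_over subring_generated_algebra)
  have coeff_poly: "[:f:] \<in> polys_over (polynomials n)" if "f \<in> polynomials n" for f
    using that subring_generated_algebra unfolding polynomials_def
    by (auto simp: polys_over_def coeff_pCons subring_def split: nat.splits)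
  have x: "[:0, 1:] \<in> polys_over (polynomials n)"
    using subring_generated_algebra unfolding polynomials_def
    by (auto simp: polys_over_def coeff_pCons subring_def split: nat.splits)
  fix f assume "f \<in> polynomials (Suc n)"
  then show "f \<in> ?R"
    unfolding polynomials_def[of "Suc n"]
  proof (induction rule: generated_algebra.induct)
    case (generator g)
    then obtain i where i: "g = (\<lambda>x. x i)" "i < Suc n"
      by auto
    show ?case
    proof (cases "i = n")
      case True
      with x i show ?thesis
        by (auto intro!: image_eqI[of _ _ "[:0, 1:]"])
    next
      case False
      then have "[:g:] \<in> polys_over (polynomials n)"
        using i by (intro coeff_poly) (auto simp: polynomials_def intro!: generated_algebra.generator)
      then show ?thesis
        by (auto intro!: image_eqI[of _ _ "[:g:]"])
    qed
  next
    case (const c)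
    have "[:\<lambda>_. c:] \<in> polys_over (polynomials n)"
      by (rule coeff_poly) (simp add: polynomials_def generated_algebra.const)
    then show ?case
      by (auto intro!: image_eqI[of _ _ "[:\<lambda>_. c:]"])
  next
    case (add f g)
    then obtain p q where pq: "p \<in> polys_over (polynomials n)" "q \<in> polys_over (polynomials n)"
      "f = poly p (\<lambda>x. x n)" "g = poly q (\<lambda>x. x n)"
      by auto
    have "p + q \<in> polys_over (polynomials n)"
      using polys pq by (auto simp: subring_def)
    then show ?case
      by (rule rev_image_eqI) (simp add: pq(3,4) plus_fun_def)
  next
    case (mult f g)
    then obtain p q where pq: "p \<in> polys_over (polynomials n)" "q \<in> polys_over (polynomials n)"
      "f = poly p (\<lambda>x. x n)" "g = poly q (\<lambda>x. x n)"
      by auto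
    have "p * q \<in> polys_over (polynomials n)"
      using polys pq by (auto simp: subring_def)
    then show ?case
      by (rule rev_image_eqI) (simp add: pq(3,4) times_fun_def)
  qed
qed

lemma poly_in_polynomials_Suc:
  assumes "p \<in> polys_over (polynomials n)"
  shows "poly p (\<lambda>x. x n) \<in> polynomials (Suc n)"
proof -
  let ?A = "polynomials (Suc n)"
  have A: "subring ?A"
    unfolding polynomials_def by (rule subring_generated_algebra)
  have mono: "f \<in> ?A" if "f \<in> polynomials n" for f
    using that unfolding polynomials_def
    by (induction rule: generated_algebra.induct) (auto intro: generated_algebra.intros less_SucI)
  have "(\<lambda>x. x n) \<in> ?A"
    by (auto simp: polynomials_def intro: generated_algebra.generator)
  then have "(\<lambda>x. x n) ^ i \<in> ?A" for i
    by (induction i) (use A in \<open>auto simp: subring_def\<close>)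
  then have "coeff p i * (\<lambda>x. x n) ^ i \<in> ?A" for i
    using A assms mono by (auto simp: subring_def polys_over_def)
  then show ?thesis
    unfolding poly_altdef by (intro subring_sum[OF A])
qed

lemma noetherian_polynomials: "noetherian (polynomials n)"
proof (induction n)
  case 0
  have const: "\<exists>c. f = (\<lambda>_. c)" if "f \<in> polynomials 0" for f
    using that unfolding polynomials_def by (induction rule: generated_algebra.induct) auto
  show ?case
    unfolding noetherian_def
  proof (intro allI impI)
    fix f :: "nat \<Rightarrow> (nat \<Rightarrow> real) \<Rightarrow> real"
    assume f: "range f \<subseteq> polynomials 0"
    obtain c d where cd: "f 0 = (\<lambda>_. c)" "f 1 = (\<lambda>_. d)"
      using const f by (meson rangeI subsetD)
    show "\<exists>n. f n \<in> ideal_span (polynomials 0) (f ` {..<n})"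
    proof (cases "c = 0")
      case True
      then have "f 0 = 0"
        using cd by (simp add: zero_fun_def)
      then show ?thesis
        using ideal_span.zero by metis
    next
      case False
      have "(\<lambda>_. d / c) * f 0 + 0 \<in> ideal_span (polynomials 0) (f ` {..<1})"
        by (intro ideal_span.intros) (auto simp: polynomials_def intro: generated_algebra.const)
      moreover have "(\<lambda>_. d / c) * f 0 + 0 = f 1"
        using False cd by (simp add: times_fun_def)
      ultimately show ?thesis
        by metis
    qed
  qed
next
  case (Suc n)
  have "polynomials (Suc n) = (\<lambda>p. poly p (\<lambda>x. x n)) ` polys_over (polynomials n)"
    using polynomials_Suc_subset poly_in_polynomials_Suc by blast
  then show ?case
    using noetherian_adjoin[OF _ Suc, of "\<lambda>x. x n"] subring_generated_algebra
    unfolding polynomials_def by metis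
qed

text \<open>
  The geometric form of the basis theorem: the Zariski topology is noetherian. It is responsible for
  all finiteness below, namely single equations for open sets, global denominators for regular
  functions, and finite covers.
\<close>

lemma finite_zero_locus:
  assumes "F \<subseteq> polynomials n"
  shows "\<exists>F'. finite F' \<and> F' \<subseteq> F \<and> (\<forall>z. (\<forall>g\<in>F'. g z = 0) \<longrightarrow> (\<forall>f\<in>F. f z = 0))"
proof (rule ccontr)
  assume neg: "\<not> ?thesis"
  define fresh where "fresh S r \<longleftrightarrow> (\<exists>z. (\<forall>g\<in>S. g z = 0) \<and> r z \<noteq> 0)"
    for S :: "((nat \<Rightarrow> real) \<Rightarrow> real) set" and r :: "(nat \<Rightarrow> real) \<Rightarrow> real"
  have "\<exists>r\<in>F. fresh S r" if "finite S" "S \<subseteq> F" for S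
  proof -
    have "\<exists>z. (\<forall>g\<in>S. g z = 0) \<and> \<not> (\<forall>f\<in>F. f z = 0)"
      using neg that by simp
    then show ?thesis
      unfolding fresh_def by (elim exE conjE) (simp, metis)
  qed
  from greedy_sequence[of F fresh, OF this]
  obtain f :: "nat \<Rightarrow> (nat \<Rightarrow> real) \<Rightarrow> real" where f: "\<forall>k. f k \<in> F \<and> fresh (f ` {..<k}) (f k)" ..
  have "range f \<subseteq> polynomials n"
    using f assms by blast
  then obtain k where k: "f k \<in> ideal_span (polynomials n) (f ` {..<k})"
    using noetherian_polynomials[of n] unfolding noetherian_def by blast
  obtain z where z: "\<forall>g\<in>f ` {..<k}. g z = 0" "f k z \<noteq> 0"
    using f unfolding fresh_def by blast
  have "h z = 0" if "h \<in> ideal_span (polynomials n) (f ` {..<k})" for h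
    using that by (induction rule: ideal_span.induct) (use z in \<open>auto simp del: image_iff\<close>)
  with k z show False
    by blast
qed

section \<open>Affine coordinates\<close>

lemma polynomials_var: "i < n \<Longrightarrow> (\<lambda>x. x i) \<in> polynomials n"
  by (auto simp: polynomials_def intro!: generated_algebra.generator)

lemma polynomials_const: "(\<lambda>_. c) \<in> polynomials n"
  by (simp add: polynomials_def generated_algebra.const)

lemma polynomials_add: "P \<in> polynomials n \<Longrightarrow> Q \<in> polynomials n \<Longrightarrow> (\<lambda>x. P x + Q x) \<in> polynomials n"
  by (simp add: polynomials_def generated_algebra.add)

lemma polynomials_mult: "P \<in> polynomials n \<Longrightarrow> Q \<in> polynomials n \<Longrightarrow> (\<lambda>x. P x * Q x) \<in> polynomials n"
  by (simp add: polynomials_def generated_algebra.mult)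

lemma polynomials_diff:
  assumes "P \<in> polynomials n" "Q \<in> polynomials n"
  shows "(\<lambda>x. P x - Q x) \<in> polynomials n"
  using polynomials_add[OF assms(1) polynomials_mult[OF polynomials_const[of "-1"] assms(2)]] by simp

lemma polynomials_sum: "(\<And>i. i \<in> I \<Longrightarrow> P i \<in> polynomials n) \<Longrightarrow> (\<lambda>x. \<Sum>i\<in>I. P i x) \<in> polynomials n"
  unfolding polynomials_def by (rule generated_algebra_sum)

lemma polynomials_prod: "(\<And>i. i \<in> I \<Longrightarrow> P i \<in> polynomials n) \<Longrightarrow> (\<lambda>x. \<Prod>i\<in>I. P i x) \<in> polynomials n"
  unfolding polynomials_def by (rule generated_algebra_prod)

lemma polynomials_power: "P \<in> polynomials n \<Longrightarrow> (\<lambda>x. P x ^ d) \<in> polynomials n"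
  unfolding polynomials_def by (rule generated_algebra_power)

lemmas polynomials_intros = polynomials_var polynomials_const polynomials_add polynomials_mult
  polynomials_diff polynomials_sum polynomials_prod polynomials_power

lemma polynomials_induct [consumes 1, case_names var const add mult]:
  assumes "P \<in> polynomials n"
    and "\<And>i. i < n \<Longrightarrow> A (\<lambda>x. x i)"
    and "\<And>c. A (\<lambda>_. c)"
    and "\<And>P Q. P \<in> polynomials n \<Longrightarrow> Q \<in> polynomials n \<Longrightarrow> A P \<Longrightarrow> A Q \<Longrightarrow> A (\<lambda>x. P x + Q x)"
    and "\<And>P Q. P \<in> polynomials n \<Longrightarrow> Q \<in> polynomials n \<Longrightarrow> A P \<Longrightarrow> A Q \<Longrightarrow> A (\<lambda>x. P x * Q x)"
  shows "A P"
  using assms(1) unfolding polynomials_def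
proof (induction rule: generated_algebra.induct)
  case (add P Q)
  then show ?case by (intro assms(4)) (simp_all add: polynomials_def)
next
  case (mult P Q)
  then show ?case by (intro assms(5)) (simp_all add: polynomials_def)
qed (use assms(2,3) in auto)

lemma generated_algebra_subst:
  assumes "P \<in> polynomials n" "\<And>i. i < n \<Longrightarrow> (\<lambda>z. c z i) \<in> generated_algebra G"
  shows "(\<lambda>z. P (c z)) \<in> generated_algebra G"
  using assms(1)
proof (induction rule: polynomials_induct)
  case (add P Q)
  then show ?case by (intro generated_algebra.add)
next
  case (mult P Q)
  then show ?case by (intro generated_algebra.mult)
qed (simp_all add: assms(2) generated_algebra.const)

lemma polynomials_subst:
  assumes "P \<in> polynomials n" "\<And>i. i < n \<Longrightarrow> (\<lambda>z. c z i) \<in> polynomials m"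
  shows "(\<lambda>z. P (c z)) \<in> polynomials m"
  using assms unfolding polynomials_def[of m] by (rule generated_algebra_subst)

text \<open>
  Regularity in terms of coordinates \<open>x\<close>, with numerator and denominator valid on all of \<open>W\<close>.
\<close>

definition fraction_on :: "nat \<Rightarrow> ('a \<Rightarrow> nat \<Rightarrow> real) \<Rightarrow> 'a set \<Rightarrow> ('a \<Rightarrow> real) \<Rightarrow> bool" where
  "fraction_on N x W f \<longleftrightarrow>
     (\<exists>P\<in>polynomials N. \<exists>Q\<in>polynomials N. \<forall>p\<in>W. Q (x p) \<noteq> 0 \<and> f p = P (x p) / Q (x p))"

text \<open>
  The structure is induced by the map \<open>x\<close> into \<open>\<real>\<^sup>N\<close>: each open set is the nonvanishing locus of a
  single polynomial and each regular function is a single fraction. Both hold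
  for arbitrary subsets of \<open>\<real>\<^sup>N\<close> with the structure induced from \<open>\<real>\<^sup>N\<close>, because a sum of squares
  vanishes only where all its terms do.
\<close>

definition affine_coordinates :: "'a ringed_space \<Rightarrow> nat \<Rightarrow> ('a \<Rightarrow> nat \<Rightarrow> real) \<Rightarrow> bool" where
  "affine_coordinates X N x \<longleftrightarrow>
     (\<forall>W. openin (zariski X) W \<longleftrightarrow> (\<exists>P\<in>polynomials N. W = {p \<in> points X. P (x p) \<noteq> 0})) \<and>
     (\<forall>W f. openin (zariski X) W \<longrightarrow> (f \<in> regular X W \<longleftrightarrow> fraction_on N x W f))"

lemma fraction_onI:
  assumes "P \<in> polynomials N" "Q \<in> polynomials N" "\<And>p. p \<in> W \<Longrightarrow> Q (x p) \<noteq> 0 \<and> f p = P (x p) / Q (x p)"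
  shows "fraction_on N x W f"
  unfolding fraction_on_def using assms(3) by (intro bexI[OF _ assms(1)] bexI[OF _ assms(2)]) auto

lemma openin_affine:
  "affine_coordinates X N x \<Longrightarrow>
     openin (zariski X) W \<longleftrightarrow> (\<exists>P\<in>polynomials N. W = {p \<in> points X. P (x p) \<noteq> 0})"
  by (simp add: affine_coordinates_def)

lemma regular_affine:
  "affine_coordinates X N x \<Longrightarrow> openin (zariski X) W \<Longrightarrow> f \<in> regular X W \<longleftrightarrow> fraction_on N x W f"
  by (simp add: affine_coordinates_def)

lemma fraction_on_subset: "fraction_on N x W f \<Longrightarrow> V \<subseteq> W \<Longrightarrow> fraction_on N x V f"
  unfolding fraction_on_def by (meson subsetD)

lemma fraction_on_cong: "fraction_on N x W f \<Longrightarrow> (\<And>p. p \<in> W \<Longrightarrow> f p = g p) \<Longrightarrow> fraction_on N x W g"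
  unfolding fraction_on_def by (metis (no_types, lifting))

lemma fraction_on_poly: "P \<in> polynomials N \<Longrightarrow> fraction_on N x W (\<lambda>p. P (x p))"
  unfolding fraction_on_def
  by (intro bexI[of _ P] bexI[of _ "\<lambda>_. 1"]) (auto intro: polynomials_intros)

lemma fraction_on_const: "fraction_on N x W (\<lambda>_. c)"
  using fraction_on_poly[OF polynomials_const] .

lemma fraction_on_coordinate: "i < N \<Longrightarrow> fraction_on N x W (\<lambda>p. x p i)"
  by (rule fraction_on_poly[OF polynomials_var])

lemma fraction_on_add:
  assumes "fraction_on N x W f" "fraction_on N x W g"
  shows "fraction_on N x W (\<lambda>p. f p + g p)"
proof -
  obtain P Q P' Q' where *: "P \<in> polynomials N" "Q \<in> polynomials N" "P' \<in> polynomials N" "Q' \<in> polynomials N"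
    "\<And>p. p \<in> W \<Longrightarrow> Q (x p) \<noteq> 0 \<and> f p = P (x p) / Q (x p)"
    "\<And>p. p \<in> W \<Longrightarrow> Q' (x p) \<noteq> 0 \<and> g p = P' (x p) / Q' (x p)"
    using assms unfolding fraction_on_def by metis
  then show ?thesis
    unfolding fraction_on_def
    by (intro bexI[of _ "\<lambda>z. P z * Q' z + P' z * Q z"] bexI[of _ "\<lambda>z. Q z * Q' z"])
       (auto intro!: polynomials_intros simp: add_frac_eq)
qed

lemma fraction_on_mult:
  assumes "fraction_on N x W f" "fraction_on N x W g"
  shows "fraction_on N x W (\<lambda>p. f p * g p)"
proof -
  obtain P Q P' Q' where *: "P \<in> polynomials N" "Q \<in> polynomials N" "P' \<in> polynomials N" "Q' \<in> polynomials N"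
    "\<And>p. p \<in> W \<Longrightarrow> Q (x p) \<noteq> 0 \<and> f p = P (x p) / Q (x p)"
    "\<And>p. p \<in> W \<Longrightarrow> Q' (x p) \<noteq> 0 \<and> g p = P' (x p) / Q' (x p)"
    using assms unfolding fraction_on_def by metis
  then show ?thesis
    unfolding fraction_on_def
    by (intro bexI[of _ "\<lambda>z. P z * P' z"] bexI[of _ "\<lambda>z. Q z * Q' z"])
       (auto intro!: polynomials_intros)
qed

lemma fraction_on_divide:
  assumes "fraction_on N x W f" "fraction_on N x W g" "\<And>p. p \<in> W \<Longrightarrow> g p \<noteq> 0"
  shows "fraction_on N x W (\<lambda>p. f p / g p)"
proof -
  obtain P Q where *: "P \<in> polynomials N" "Q \<in> polynomials N"
    "\<And>p. p \<in> W \<Longrightarrow> Q (x p) \<noteq> 0 \<and> g p = P (x p) / Q (x p)"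
    using assms unfolding fraction_on_def by metis
  have "fraction_on N x W (\<lambda>p. inverse (g p))"
    unfolding fraction_on_def
    using * assms(3) by (intro bexI[of _ Q] bexI[of _ P]) auto
  from fraction_on_mult[OF assms(1) this] show ?thesis
    by (simp add: field_simps)
qed

lemma fraction_on_subst:
  assumes "P \<in> polynomials n" "\<And>i. i < n \<Longrightarrow> fraction_on N x W (\<lambda>p. c p i)"
  shows "fraction_on N x W (\<lambda>p. P (c p))"
  using assms(1)
proof (induction rule: polynomials_induct)
  case (var i)
  then show ?case by (rule assms(2))
next
  case (const c)
  show ?case by (rule fraction_on_const)
next
  case (add P Q)
  then show ?case by (intro fraction_on_add)
next
  case (mult P Q)
  then show ?case by (intro fraction_on_mult)
qed

lemma fraction_on_compose:
  assumes "fraction_on n y V g" "\<And>p. p \<in> W \<Longrightarrow> \<phi> p \<in> V"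
    and "\<And>i. i < n \<Longrightarrow> fraction_on N x W (\<lambda>p. y (\<phi> p) i)"
  shows "fraction_on N x W (\<lambda>p. g (\<phi> p))"
proof -
  obtain P Q where *: "P \<in> polynomials n" "Q \<in> polynomials n"
    "\<And>p. p \<in> V \<Longrightarrow> Q (y p) \<noteq> 0 \<and> g p = P (y p) / Q (y p)"
    using assms unfolding fraction_on_def by metis
  have "fraction_on N x W (\<lambda>p. P (y (\<phi> p)) / Q (y (\<phi> p)))"
    using fraction_on_subst[OF *(1), of N x W "\<lambda>p. y (\<phi> p)"]
      fraction_on_subst[OF *(2), of N x W "\<lambda>p. y (\<phi> p)"] assms(2,3) *(3)
    by (intro fraction_on_divide) blast+
  then show ?thesis
    by (rule fraction_on_cong) (use * assms(2) in auto)
qed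

text \<open>
  Local descriptions suffice. If open sets are unions of nonvanishing loci \<open>R\<^sub>a \<noteq> 0\<close>, then finitely many
  of them suffice, and the union is the nonvanishing locus of \<open>\<Sum> R\<^sub>a\<^sup>2\<close>. If a function equals
  \<open>P\<^sub>a / Q\<^sub>a\<close> on \<open>R\<^sub>a \<noteq> 0\<close>, then it equals \<open>(\<Sum> R\<^sub>a\<^sup>2 P\<^sub>a Q\<^sub>a) / (\<Sum> R\<^sub>a\<^sup>2 Q\<^sub>a\<^sup>2)\<close> everywhere.
\<close>

lemma affine_coordinatesI:
  assumes local_open: "\<And>W p. openin (zariski X) W \<Longrightarrow> p \<in> W \<Longrightarrow>
      \<exists>P\<in>polynomials N. P (x p) \<noteq> 0 \<and> {q \<in> points X. P (x q) \<noteq> 0} \<subseteq> W"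
    and open_basic: "\<And>P. P \<in> polynomials N \<Longrightarrow> openin (zariski X) {p \<in> points X. P (x p) \<noteq> 0}"
    and local_fraction: "\<And>W f p. openin (zariski X) W \<Longrightarrow> f \<in> regular X W \<Longrightarrow> p \<in> W \<Longrightarrow>
      \<exists>R\<in>polynomials N. R (x p) \<noteq> 0 \<and> fraction_on N x {q \<in> W. R (x q) \<noteq> 0} f"
    and regular_fraction: "\<And>W f. openin (zariski X) W \<Longrightarrow> fraction_on N x W f \<Longrightarrow> f \<in> regular X W"
  shows "affine_coordinates X N x"
  unfolding affine_coordinates_def
proof (intro conjI allI impI)
  fix W
  show "openin (zariski X) W \<longleftrightarrow> (\<exists>P\<in>polynomials N. W = {p \<in> points X. P (x p) \<noteq> 0})"
  proof
    assume W: "openin (zariski X) W"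
    define F where "F = {P \<in> polynomials N. {q \<in> points X. P (x q) \<noteq> 0} \<subseteq> W}"
    have "F \<subseteq> polynomials N"
      by (auto simp: F_def)
    from finite_zero_locus[OF this] obtain F' where
      F': "finite F' \<and> F' \<subseteq> F \<and> (\<forall>z. (\<forall>R\<in>F'. R z = 0) \<longrightarrow> (\<forall>P\<in>F. P z = 0))" ..
    let ?P = "\<lambda>z. \<Sum>R\<in>F'. R z * R z"
    have iff: "?P z = 0 \<longleftrightarrow> (\<forall>R\<in>F'. R z = 0)" for z
      using F' by (simp add: sum_nonneg_eq_0_iff)
    have "W = {p \<in> points X. ?P (x p) \<noteq> 0}"
    proof (intro set_eqI iffI)
      fix p assume p: "p \<in> W"
      from local_open[OF W p] obtain P where "P \<in> F" "P (x p) \<noteq> 0"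
        by (auto simp: F_def)
      then show "p \<in> {p \<in> points X. ?P (x p) \<noteq> 0}"
        using p openin_subset[OF W] F' iff[of "x p"] by blast
    next
      fix p assume "p \<in> {p \<in> points X. ?P (x p) \<noteq> 0}"
      then show "p \<in> W"
        using F' iff[of "x p"] by (auto simp: F_def)
    qed
    moreover have "?P \<in> polynomials N"
      using F' by (auto simp: F_def intro!: polynomials_intros)
    ultimately show "\<exists>P\<in>polynomials N. W = {p \<in> points X. P (x p) \<noteq> 0}"
      by (intro bexI)
  qed (use open_basic in auto)
next
  fix W f
  assume W: "openin (zariski X) W"
  show "f \<in> regular X W \<longleftrightarrow> fraction_on N x W f"
  proof
    assume f: "f \<in> regular X W"
    have "\<forall>p\<in>W. \<exists>R P Q. R \<in> polynomials N \<and> P \<in> polynomials N \<and> Q \<in> polynomials N \<and> R (x p) \<noteq> 0 \<and>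
        (\<forall>q\<in>W. R (x q) \<noteq> 0 \<longrightarrow> Q (x q) \<noteq> 0 \<and> f q = P (x q) / Q (x q))"
    proof
      fix p assume "p \<in> W"
      from local_fraction[OF W f this] obtain R where
        R: "R \<in> polynomials N" "R (x p) \<noteq> 0" "fraction_on N x {q \<in> W. R (x q) \<noteq> 0} f"
        by auto
      from R(3) obtain P Q where "P \<in> polynomials N" "Q \<in> polynomials N"
        "\<forall>q\<in>{q \<in> W. R (x q) \<noteq> 0}. Q (x q) \<noteq> 0 \<and> f q = P (x q) / Q (x q)"
        unfolding fraction_on_def by auto
      with R(1,2) show "\<exists>R P Q. R \<in> polynomials N \<and> P \<in> polynomials N \<and> Q \<in> polynomials N \<and> R (x p) \<noteq> 0 \<and>
          (\<forall>q\<in>W. R (x q) \<noteq> 0 \<longrightarrow> Q (x q) \<noteq> 0 \<and> f q = P (x q) / Q (x q))"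
        by auto
    qed
    from bchoice[OF this] obtain R where "\<forall>p\<in>W. \<exists>P Q. R p \<in> polynomials N \<and> P \<in> polynomials N \<and>
        Q \<in> polynomials N \<and> R p (x p) \<noteq> 0 \<and>
        (\<forall>q\<in>W. R p (x q) \<noteq> 0 \<longrightarrow> Q (x q) \<noteq> 0 \<and> f q = P (x q) / Q (x q))" ..
    from bchoice[OF this] obtain P where "\<forall>p\<in>W. \<exists>Q. R p \<in> polynomials N \<and> P p \<in> polynomials N \<and>
        Q \<in> polynomials N \<and> R p (x p) \<noteq> 0 \<and>
        (\<forall>q\<in>W. R p (x q) \<noteq> 0 \<longrightarrow> Q (x q) \<noteq> 0 \<and> f q = P p (x q) / Q (x q))" ..
    from bchoice[OF this] obtain Q where RPQ: "\<forall>p\<in>W. R p \<in> polynomials N \<and> P p \<in> polynomials N \<and>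
        Q p \<in> polynomials N \<and> R p (x p) \<noteq> 0 \<and>
        (\<forall>q\<in>W. R p (x q) \<noteq> 0 \<longrightarrow> Q p (x q) \<noteq> 0 \<and> f q = P p (x q) / Q p (x q))" ..
    then have poly: "\<And>p. p \<in> W \<Longrightarrow> R p \<in> polynomials N"
      "\<And>p. p \<in> W \<Longrightarrow> P p \<in> polynomials N" "\<And>p. p \<in> W \<Longrightarrow> Q p \<in> polynomials N"
      and R: "\<And>p. p \<in> W \<Longrightarrow> R p (x p) \<noteq> 0"
      and f_eq: "\<And>p q. p \<in> W \<Longrightarrow> q \<in> W \<Longrightarrow> R p (x q) \<noteq> 0 \<Longrightarrow> Q p (x q) \<noteq> 0 \<and> f q = P p (x q) / Q p (x q)"
      by simp_all
    have "R ` W \<subseteq> polynomials N"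
      using poly by auto
    from finite_zero_locus[OF this] obtain F' where
      F': "finite F' \<and> F' \<subseteq> R ` W \<and> (\<forall>z. (\<forall>T\<in>F'. T z = 0) \<longrightarrow> (\<forall>S\<in>R ` W. S z = 0))" ..
    obtain A where A: "A \<subseteq> W" "finite A" "F' = R ` A"
      using finite_subset_image[of F' R W] F' by auto
    \<comment> \<open>the summand for \<open>a\<close> is zero in both sums where \<open>R a\<close> vanishes, and has ratio \<open>f\<close> elsewhere\<close>
    let ?P = "\<lambda>z. \<Sum>a\<in>A. (R a z * R a z) * (P a z * Q a z)"
    let ?Q = "\<lambda>z. \<Sum>a\<in>A. (R a z * Q a z) * (R a z * Q a z)"
    have "?P \<in> polynomials N" "?Q \<in> polynomials N"
      using poly A(1) by (auto intro!: polynomials_intros)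
    moreover have "?Q (x q) \<noteq> 0 \<and> f q = ?P (x q) / ?Q (x q)" if q: "q \<in> W" for q
    proof -
      obtain a where a: "a \<in> A" "R a (x q) \<noteq> 0"
        using F' R[OF q] q A(3) by blast
      then have "(R a (x q) * Q a (x q)) * (R a (x q) * Q a (x q)) > 0"
        using f_eq[of a q] A(1) q by (metis mult_eq_0_iff not_real_square_gt_zero subsetD)
      then have "?Q (x q) > 0"
        using A(2) a(1) by (intro sum_pos2[of A a]) auto
      moreover have "?P (x q) = f q * ?Q (x q)"
        unfolding sum_distrib_left
      proof (rule sum.cong)
        fix b assume "b \<in> A"
        then show "(R b (x q) * R b (x q)) * (P b (x q) * Q b (x q)) =
            f q * ((R b (x q) * Q b (x q)) * (R b (x q) * Q b (x q)))"
          using f_eq[of b q] A(1) q by (cases "R b (x q) = 0") auto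
      qed simp
      ultimately show ?thesis
        by simp
    qed
    ultimately show "fraction_on N x W f"
      by (rule fraction_onI)
  qed (rule regular_fraction[OF W])
qed

section \<open>Regular maps in coordinates\<close>

lemma preimage_affine:
  assumes "fraction_on N x (points X) f" "affine_coordinates X N x"
  shows "openin (zariski X) {p \<in> points X. f p \<noteq> 0}"
proof -
  obtain P Q where *: "P \<in> polynomials N" "Q \<in> polynomials N"
    "\<And>p. p \<in> points X \<Longrightarrow> Q (x p) \<noteq> 0 \<and> f p = P (x p) / Q (x p)"
    using assms unfolding fraction_on_def by metis
  then have "{p \<in> points X. f p \<noteq> 0} = {p \<in> points X. P (x p) \<noteq> 0}"
    by auto
  then show ?thesis
    using *(1) assms(2) by (auto simp: openin_affine)
qed

text \<open>
  Opens and regular functions of the target are expressed by polynomials in its coordinates, so it is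
  enough to pull back the coordinates.
\<close>

lemma regular_mapI:
  assumes X: "affine_coordinates X N x" and Y: "affine_coordinates Y M y"
    and \<phi>: "\<And>p. p \<in> points X \<Longrightarrow> \<phi> p \<in> points Y"
    and coord: "\<And>j. j < M \<Longrightarrow> fraction_on N x (points X) (\<lambda>p. y (\<phi> p) j)"
  shows "regular_map X Y \<phi>"
proof -
  have pre: "openin (zariski X) {p \<in> points X. \<phi> p \<in> V}" if "openin (zariski Y) V" for V
  proof -
    from that Y obtain P where P: "P \<in> polynomials M" "V = {q \<in> points Y. P (y q) \<noteq> 0}"
      by (auto simp: openin_affine)
    have "{p \<in> points X. \<phi> p \<in> V} = {p \<in> points X. P (y (\<phi> p)) \<noteq> 0}"
      using P \<phi> by auto
    moreover have "fraction_on N x (points X) (\<lambda>p. P (y (\<phi> p)))"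
      using P(1) coord by (rule fraction_on_subst[where c = "\<lambda>p. y (\<phi> p)"])
    ultimately show ?thesis
      using preimage_affine[OF _ X] by simp
  qed
  have "g \<circ> \<phi> \<in> regular X {p \<in> points X. \<phi> p \<in> V}" if "openin (zariski Y) V" "g \<in> regular Y V" for V g
    unfolding regular_affine[OF X pre[OF that(1)]] comp_def
  proof (rule fraction_on_compose[where g = g and \<phi> = \<phi> and V = V and y = y and n = M])
    show "fraction_on M y V g"
      using that Y by (simp add: regular_affine)
    show "fraction_on N x {p \<in> points X. \<phi> p \<in> V} (\<lambda>p. y (\<phi> p) i)" if "i < M" for i
      using coord[OF that] by (rule fraction_on_subset) auto
  qed auto
  then show ?thesis
    unfolding regular_map_def continuous_map_def using pre \<phi> by auto
qed

lemma regular_map_points: "regular_map X Y \<phi> \<Longrightarrow> p \<in> points X \<Longrightarrow> \<phi> p \<in> points Y"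
  by (auto simp: regular_map_def continuous_map_def)

lemma regular_map_preimage:
  "regular_map X Y \<phi> \<Longrightarrow> openin (zariski Y) V \<Longrightarrow> openin (zariski X) {p \<in> points X. \<phi> p \<in> V}"
  by (auto simp: regular_map_def continuous_map_def)

lemma regular_map_pullback:
  "regular_map X Y \<phi> \<Longrightarrow> openin (zariski Y) V \<Longrightarrow> g \<in> regular Y V \<Longrightarrow>
     g \<circ> \<phi> \<in> regular X {p \<in> points X. \<phi> p \<in> V}"
  by (auto simp: regular_map_def)

lemma regular_map_coordinate:
  assumes X: "affine_coordinates X N x" and Y: "affine_coordinates Y M y"
    and \<phi>: "regular_map X Y \<phi>" and j: "j < M"
  shows "fraction_on N x (points X) (\<lambda>p. y (\<phi> p) j)"
proof -
  have "(\<lambda>q. y q j) \<in> regular Y (points Y)"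
    using fraction_on_coordinate[OF j] by (simp add: regular_affine[OF Y])
  then have "(\<lambda>q. y q j) \<circ> \<phi> \<in> regular X {p \<in> points X. \<phi> p \<in> points Y}"
    using \<phi> unfolding regular_map_def by blast
  moreover have "{p \<in> points X. \<phi> p \<in> points Y} = points X"
    using regular_map_points[OF \<phi>] by auto
  ultimately show ?thesis
    by (simp add: regular_affine[OF X] comp_def)
qed

lemma regular_map_compose:
  assumes "regular_map X Y \<phi>" "regular_map Y Z \<psi>"
  shows "regular_map X Z (\<psi> \<circ> \<phi>)"
  unfolding regular_map_def
proof (intro conjI allI impI)
  show "continuous_map (zariski X) (zariski Z) (\<psi> \<circ> \<phi>)"
    using assms by (auto simp: regular_map_def intro: continuous_map_compose)
  fix V g assume V: "openin (zariski Z) V" "g \<in> regular Z V"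
  let ?V = "{q \<in> points Y. \<psi> q \<in> V}"
  have "(g \<circ> \<psi>) \<circ> \<phi> \<in> regular X {p \<in> points X. \<phi> p \<in> ?V}"
    using regular_map_preimage[OF assms(2) V(1)] regular_map_pullback[OF assms(2) V]
    by (rule regular_map_pullback[OF assms(1)])
  moreover have "{p \<in> points X. \<phi> p \<in> ?V} = {p \<in> points X. (\<psi> \<circ> \<phi>) p \<in> V}"
    using regular_map_points[OF assms(1)] by auto
  ultimately show "g \<circ> (\<psi> \<circ> \<phi>) \<in> regular X {p \<in> points X. (\<psi> \<circ> \<phi>) p \<in> V}"
    by (simp add: comp_assoc)
qed

section \<open>Induced structures and isomorphisms\<close>

lemma points_induced_space: "points (induced_space X S) = points X \<inter> S"
  by (simp add: induced_space_def)

lemma affine_coordinates_induced: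
  assumes X: "affine_coordinates X N x"
  shows "affine_coordinates (induced_space X S) N x"
proof (rule affine_coordinatesI)
  fix W p assume "openin (zariski (induced_space X S)) W" "p \<in> W"
  then obtain T where T: "openin (zariski X) T" "W = T \<inter> S"
    by (auto simp: induced_space_def openin_subtopology)
  with X obtain P where "P \<in> polynomials N" "T = {q \<in> points X. P (x q) \<noteq> 0}"
    by (auto simp: openin_affine)
  with T \<open>p \<in> W\<close> show "\<exists>P\<in>polynomials N. P (x p) \<noteq> 0 \<and> {q \<in> points (induced_space X S). P (x q) \<noteq> 0} \<subseteq> W"
    by (auto simp: points_induced_space)
next
  fix P assume "P \<in> polynomials N"
  then have "openin (zariski X) {q \<in> points X. P (x q) \<noteq> 0}"
    using X by (auto simp: openin_affine)
  moreover have "{q \<in> points (induced_space X S). P (x q) \<noteq> 0} = {q \<in> points X. P (x q) \<noteq> 0} \<inter> S"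
    by (auto simp: points_induced_space)
  ultimately show "openin (zariski (induced_space X S)) {q \<in> points (induced_space X S). P (x q) \<noteq> 0}"
    by (auto simp: induced_space_def openin_subtopology)
next
  fix W f p assume W: "openin (zariski (induced_space X S)) W" "f \<in> regular (induced_space X S) W" "p \<in> W"
  then obtain V g where V: "openin (zariski X) V" "p \<in> V" "g \<in> regular X V" "\<forall>z\<in>V \<inter> W. f z = g z"
    by (auto simp: induced_space_def)
  from V(1) X obtain R where R: "R \<in> polynomials N" "V = {q \<in> points X. R (x q) \<noteq> 0}"
    by (auto simp: openin_affine)
  have sub: "{q \<in> W. R (x q) \<noteq> 0} \<subseteq> V"
    using openin_subset[OF W(1)] R by (auto simp: points_induced_space)
  have "fraction_on N x V g"
    using V X by (simp add: regular_affine)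
  from fraction_on_subset[OF this sub] have "fraction_on N x {q \<in> W. R (x q) \<noteq> 0} f"
    by (rule fraction_on_cong) (use V(4) sub in auto)
  then show "\<exists>R\<in>polynomials N. R (x p) \<noteq> 0 \<and> fraction_on N x {q \<in> W. R (x q) \<noteq> 0} f"
    using R V(2) by auto
next
  fix W f assume W: "openin (zariski (induced_space X S)) W" "fraction_on N x W f"
  then obtain T where T: "openin (zariski X) T" "W = T \<inter> S"
    by (auto simp: induced_space_def openin_subtopology)
  obtain P Q where PQ: "P \<in> polynomials N" "Q \<in> polynomials N"
    "\<And>p. p \<in> W \<Longrightarrow> Q (x p) \<noteq> 0 \<and> f p = P (x p) / Q (x p)"
    using W(2) unfolding fraction_on_def by metis
  let ?V = "{q \<in> points X. Q (x q) \<noteq> 0}" and ?g = "\<lambda>q. P (x q) / Q (x q)"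
  have V: "openin (zariski X) ?V"
    using X PQ by (auto simp: openin_affine)
  have g: "?g \<in> regular X ?V"
    unfolding regular_affine[OF X V] fraction_on_def using PQ by auto
  have "p \<in> ?V" if "p \<in> W" for p
    using that PQ(3) openin_subset[OF W(1)] by (auto simp: points_induced_space)
  moreover have "\<forall>z\<in>?V \<inter> W. f z = ?g z"
    using PQ(3) by blast
  ultimately show "f \<in> regular (induced_space X S) W"
    using V g unfolding induced_space_def by (simp, blast)
qed

lemma affine_coordinates_iso:
  assumes iso: "ringed_iso X Z \<phi>" and Z: "affine_coordinates Z N z"
  shows "affine_coordinates X N (z \<circ> \<phi>)"
proof -
  obtain \<psi> where homeo: "homeomorphic_maps (zariski X) (zariski Z) \<phi> \<psi>"
    and reg: "\<And>U f. openin (zariski X) U \<Longrightarrow> f \<in> regular X U \<longleftrightarrow> f \<circ> \<psi> \<in> regular Z (\<phi> ` U)"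
    using iso unfolding ringed_iso_def by blast
  have \<phi>: "homeomorphic_map (zariski X) (zariski Z) \<phi>"
    using homeo homeomorphic_map_maps by blast
  have inv: "\<And>p. p \<in> points X \<Longrightarrow> \<psi> (\<phi> p) = p" "\<And>q. q \<in> points Z \<Longrightarrow> \<phi> (\<psi> q) = q"
    and maps: "\<And>p. p \<in> points X \<Longrightarrow> \<phi> p \<in> points Z" "\<And>q. q \<in> points Z \<Longrightarrow> \<psi> q \<in> points X"
    using homeo by (auto simp: homeomorphic_maps_def continuous_map_def)
  have image: "\<phi> ` {p \<in> points X. P (z (\<phi> p)) \<noteq> 0} = {q \<in> points Z. P (z q) \<noteq> 0}" for P
    using inv maps by (auto simp: image_iff) metis
  have open_iff: "openin (zariski X) U \<longleftrightarrow> (\<exists>P\<in>polynomials N. U = {p \<in> points X. P ((z \<circ> \<phi>) p) \<noteq> 0})" for U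
  proof
    assume U: "openin (zariski X) U"
    then have "openin (zariski Z) (\<phi> ` U)"
      using \<phi> homeomorphic_map_openness_eq by blast
    with Z obtain P where P: "P \<in> polynomials N" "\<phi> ` U = {q \<in> points Z. P (z q) \<noteq> 0}"
      by (auto simp: openin_affine)
    have "U = \<psi> ` \<phi> ` U"
      using inv openin_subset[OF U] by (force simp: image_iff)
    also have "\<dots> = {p \<in> points X. P (z (\<phi> p)) \<noteq> 0}"
      unfolding P(2) image[symmetric] using inv by (force simp: image_iff)
    finally show "\<exists>P\<in>polynomials N. U = {p \<in> points X. P ((z \<circ> \<phi>) p) \<noteq> 0}"
      using P(1) by auto
  next
    assume "\<exists>P\<in>polynomials N. U = {p \<in> points X. P ((z \<circ> \<phi>) p) \<noteq> 0}"
    then obtain P where P: "P \<in> polynomials N" "U = {p \<in> points X. P (z (\<phi> p)) \<noteq> 0}"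
      by auto
    have "openin (zariski Z) (\<phi> ` U)"
      using P Z image by (auto simp: openin_affine)
    then show "openin (zariski X) U"
      using \<phi> P(2) homeomorphic_map_openness_eq by blast
  qed
  moreover have "f \<in> regular X U \<longleftrightarrow> fraction_on N (z \<circ> \<phi>) U f" if U: "openin (zariski X) U" for U f
  proof -
    have "openin (zariski Z) (\<phi> ` U)"
      using \<phi> U homeomorphic_map_openness_eq by blast
    then have "f \<in> regular X U \<longleftrightarrow> fraction_on N z (\<phi> ` U) (f \<circ> \<psi>)"
      using reg[OF U] regular_affine[OF Z] by blast
    also have "\<dots> \<longleftrightarrow> fraction_on N (z \<circ> \<phi>) U f"
      using inv openin_subset[OF U] by (auto simp: fraction_on_def subset_iff)
    finally show ?thesis .
  qed
  ultimately show ?thesis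
    unfolding affine_coordinates_def by blast
qed

lemma ringed_iso_regular_maps:
  assumes iso: "ringed_iso X Z \<phi>" and Z: "affine_coordinates Z N z"
  obtains \<psi> where "regular_map X Z \<phi>" "regular_map Z X \<psi>"
    "\<And>p. p \<in> points X \<Longrightarrow> \<psi> (\<phi> p) = p" "\<And>q. q \<in> points Z \<Longrightarrow> \<phi> (\<psi> q) = q"
proof -
  obtain \<psi> where homeo: "homeomorphic_maps (zariski X) (zariski Z) \<phi> \<psi>"
    using iso unfolding ringed_iso_def by blast
  have inv: "\<And>p. p \<in> points X \<Longrightarrow> \<psi> (\<phi> p) = p" "\<And>q. q \<in> points Z \<Longrightarrow> \<phi> (\<psi> q) = q"
    and maps: "\<And>p. p \<in> points X \<Longrightarrow> \<phi> p \<in> points Z" "\<And>q. q \<in> points Z \<Longrightarrow> \<psi> q \<in> points X"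
    using homeo by (auto simp: homeomorphic_maps_def continuous_map_def)
  have X: "affine_coordinates X N (z \<circ> \<phi>)"
    by (rule affine_coordinates_iso[OF iso Z])
  have "regular_map X Z \<phi>"
    by (rule regular_mapI[OF X Z maps(1)]) (use fraction_on_coordinate[of _ N "z \<circ> \<phi>"] in auto)
  moreover have "regular_map Z X \<psi>"
  proof (rule regular_mapI[OF Z X maps(2)])
    show "fraction_on N z (points Z) (\<lambda>p. (z \<circ> \<phi>) (\<psi> p) j)" if "j < N" for j
      by (rule fraction_on_cong[OF fraction_on_coordinate[OF that]]) (simp add: inv(2))
  qed
  ultimately show thesis
    using inv by (rule that)
qed

section \<open>Products with real vector spaces\<close>

text \<open>
  The form of the criterion for a topology generated by nonvanishing loci, which is how the topologies of
  projective spaces and of products are given.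
\<close>

lemma affine_coordinates_generatedI:
  assumes zariski: "zariski X = topology_generated_by \<B>"
    and basic: "\<And>b. b \<in> \<B> \<Longrightarrow> \<exists>P\<in>polynomials N. b = {p \<in> S. P (x p) \<noteq> 0}"
    and generated: "\<And>P. P \<in> polynomials N \<Longrightarrow> {p \<in> S. P (x p) \<noteq> 0} \<in> \<B>"
    and local_fraction: "\<And>W f p. openin (zariski X) W \<Longrightarrow> W \<subseteq> S \<Longrightarrow> f \<in> regular X W \<Longrightarrow> p \<in> W \<Longrightarrow>
      \<exists>V. openin (zariski X) V \<and> p \<in> V \<and> fraction_on N x (W \<inter> V) f"
    and regular_fraction: "\<And>W f. openin (zariski X) W \<Longrightarrow> W \<subseteq> S \<Longrightarrow> fraction_on N x W f \<Longrightarrow> f \<in> regular X W"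
  shows "points X = S" and "affine_coordinates X N x"
proof -
  have "S \<in> \<B>"
    using generated[OF polynomials_const[of 1]] by simp
  moreover have "b \<subseteq> S" if "b \<in> \<B>" for b
    using basic[OF that] by auto
  ultimately show pts: "points X = S"
    unfolding zariski topology_generated_by_topspace by blast
  have local_open: "\<exists>P\<in>polynomials N. P (x p) \<noteq> 0 \<and> {q \<in> S. P (x q) \<noteq> 0} \<subseteq> W"
    if W: "openin (zariski X) W" "p \<in> W" for W p
  proof -
    from W(1) have "generate_topology_on \<B> W"
      by (simp add: zariski openin_topology_generated_by_iff)
    then show ?thesis
      using W(2)
    proof (induction rule: generate_topology_on.induct)
      case (Int a b)
      then obtain P Q where "P \<in> polynomials N" "P (x p) \<noteq> 0" "{q \<in> S. P (x q) \<noteq> 0} \<subseteq> a"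
        "Q \<in> polynomials N" "Q (x p) \<noteq> 0" "{q \<in> S. Q (x q) \<noteq> 0} \<subseteq> b"
        by auto
      then show ?case
        by (intro bexI[of _ "\<lambda>z. P z * Q z"]) (auto intro: polynomials_intros)
    next
      case (UN K)
      then obtain k where k: "k \<in> K" "p \<in> k"
        by auto
      then obtain P where "P \<in> polynomials N" "P (x p) \<noteq> 0" "{q \<in> S. P (x q) \<noteq> 0} \<subseteq> k"
        using UN by blast
      then show ?case
        using k by (intro bexI[of _ P]) auto
    next
      case (Basis s)
      then show ?case
        using basic[of s] by auto
    qed simp
  qed
  show "affine_coordinates X N x"
  proof (rule affine_coordinatesI)
    fix W p assume "openin (zariski X) W" "p \<in> W"
    from local_open[OF this] show "\<exists>P\<in>polynomials N. P (x p) \<noteq> 0 \<and> {q \<in> points X. P (x q) \<noteq> 0} \<subseteq> W"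
      unfolding pts .
  next
    fix P assume "P \<in> polynomials N"
    from generated[OF this] show "openin (zariski X) {p \<in> points X. P (x p) \<noteq> 0}"
      unfolding pts unfolding zariski by (rule topology_generated_by_Basis)
  next
    fix W f p assume W: "openin (zariski X) W" "f \<in> regular X W" "p \<in> W"
    have sub: "W \<subseteq> S"
      using openin_subset[OF W(1)] pts by simp
    from local_fraction[OF W(1) sub W(2,3)] obtain V where
      V: "openin (zariski X) V \<and> p \<in> V \<and> fraction_on N x (W \<inter> V) f" ..
    then obtain R where R: "R \<in> polynomials N" "R (x p) \<noteq> 0" "{q \<in> S. R (x q) \<noteq> 0} \<subseteq> V"
      using local_open[of V p] by auto
    have "fraction_on N x {q \<in> W. R (x q) \<noteq> 0} f"
      by (rule fraction_on_subset[OF V[THEN conjunct2, THEN conjunct2]]) (use R(3) sub in auto)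
    with R show "\<exists>R\<in>polynomials N. R (x p) \<noteq> 0 \<and> fraction_on N x {q \<in> W. R (x q) \<noteq> 0} f"
      by blast
  next
    fix W f assume W: "openin (zariski X) W" "fraction_on N x W f"
    then show "f \<in> regular X W"
      using openin_subset[OF W(1)] pts by (intro regular_fraction) auto
  qed
qed

text \<open>
  Coordinates of a point of \<open>Y \<times> \<real>\<^sup>n\<close>: the \<open>N\<close> coordinates of the base point come first.
\<close>

definition join :: "nat \<Rightarrow> (nat \<Rightarrow> real) \<Rightarrow> (nat \<Rightarrow> real) \<Rightarrow> nat \<Rightarrow> real" where
  "join N u v = (\<lambda>i. if i < N then u i else v (i - N))"

definition product_coordinates ::
    "nat \<Rightarrow> ('a \<Rightarrow> nat \<Rightarrow> real) \<Rightarrow> 'a \<times> (nat \<Rightarrow> real) \<Rightarrow> nat \<Rightarrow> real" where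
  "product_coordinates N x = (\<lambda>(y, v). join N (x y) v)"

lemma fraction_on_base:
  assumes "fraction_on N x S f" "fst ` W \<subseteq> S"
  shows "fraction_on (N + n) (product_coordinates N x) W (\<lambda>z. f (fst z))"
proof (rule fraction_on_compose[where g = f and \<phi> = fst and V = S and y = x and n = N])
  fix i assume i: "i < N"
  have "fraction_on (N + n) (product_coordinates N x) W (\<lambda>z. product_coordinates N x z i)"
    using i by (intro fraction_on_coordinate) simp
  moreover have "product_coordinates N x z i = x (fst z) i" for z
    using i by (cases z) (simp add: product_coordinates_def join_def)
  ultimately show "fraction_on (N + n) (product_coordinates N x) W (\<lambda>z. x (fst z) i)"
    by simp
qed (use assms in auto)

lemma fraction_on_fibre_coordinate:
  assumes "i < n"
  shows "fraction_on (N + n) (product_coordinates N x) W (\<lambda>z. snd z i)"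
proof -
  have "fraction_on (N + n) (product_coordinates N x) W (\<lambda>z. product_coordinates N x z (N + i))"
    using assms by (intro fraction_on_coordinate) simp
  moreover have "product_coordinates N x z (N + i) = snd z i" for z
    by (cases z) (simp add: product_coordinates_def join_def)
  ultimately show ?thesis
    by simp
qed

text \<open>
  The generators of the ring of product functions are fractions in the coordinates of the base, or
  fibre coordinates. Clearing denominators turns fractions of product functions into fractions of
  polynomials.
\<close>

lemma affine_coordinates_product:
  assumes Y: "affine_coordinates Y N x"
  shows "points (product_space Y n) = points Y \<times> Rn n"
    and "affine_coordinates (product_space Y n) (N + n) (product_coordinates N x)"
proof -
  let ?x = "product_coordinates N x" and ?S = "points Y \<times> Rn n"
  let ?B = "{{z \<in> ?S. h z \<noteq> 0} |h. h \<in> product_functions Y n}"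
  have zariski: "zariski (product_space Y n) = topology_generated_by ?B"
    by (simp add: product_space_def)
  have fraction: "fraction_on (N + n) ?x W h" if "h \<in> product_functions Y n" "W \<subseteq> ?S" for h W
    using that(1) unfolding product_functions_def
  proof (induction rule: generated_algebra.induct)
    case (generator g)
    then consider f where "f \<in> regular Y (points Y)" "g = (\<lambda>z. f (fst z))"
      | i where "i < n" "g = (\<lambda>z. snd z i)"
      by (auto simp: case_prod_unfold)
    then show ?case
    proof cases
      case (1 f)
      then have "fraction_on N x (points Y) f"
        by (simp add: regular_affine[OF Y])
      moreover have "fst ` W \<subseteq> points Y"
        using that(2) by auto
      ultimately show ?thesis
        unfolding 1(2) by (rule fraction_on_base)
    next
      case (2 i)
      then show ?thesis
        by (simp add: fraction_on_fibre_coordinate)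
    qed
  next
    case (const c)
    show ?case by (rule fraction_on_const)
  next
    case (add f g)
    then show ?case by (intro fraction_on_add)
  next
    case (mult f g)
    then show ?case by (intro fraction_on_mult)
  qed
  have poly: "(\<lambda>z. P (?x z)) \<in> product_functions Y n" if P: "P \<in> polynomials (N + n)" for P
    unfolding product_functions_def
  proof (rule generated_algebra_subst[OF P])
    fix i assume i: "i < N + n"
    show "(\<lambda>z. ?x z i) \<in> generated_algebra
        ({(\<lambda>(y, v). f y) |f. f \<in> regular Y (points Y)} \<union> {(\<lambda>(y, v). v i) |i. i < n})"
    proof (cases "i < N")
      case True
      then have "(\<lambda>y. x y i) \<in> regular Y (points Y)"
        by (simp add: regular_affine[OF Y] fraction_on_coordinate)
      moreover have "(\<lambda>z. ?x z i) = (\<lambda>(y, v). x y i)"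
        using True by (auto simp: product_coordinates_def join_def)
      ultimately show ?thesis
        by (intro generated_algebra.generator UnI1 CollectI exI[of _ "\<lambda>y. x y i"]) simp
    next
      case False
      then have "i - N < n" "(\<lambda>z. ?x z i) = (\<lambda>(y, v). v (i - N))"
        using i by (auto simp: product_coordinates_def join_def)
      then show ?thesis
        by (intro generated_algebra.generator UnI2 CollectI exI[of _ "i - N"]) simp
    qed
  qed
  have basic: "\<exists>P\<in>polynomials (N + n). b = {z \<in> ?S. P (?x z) \<noteq> 0}" if "b \<in> ?B" for b
  proof -
    from that obtain h where h: "h \<in> product_functions Y n" "b = {z \<in> ?S. h z \<noteq> 0}"
      by auto
    from fraction[OF h(1) subset_refl] obtain P Q where "P \<in> polynomials (N + n)"
      "\<forall>z\<in>?S. Q (?x z) \<noteq> 0 \<and> h z = P (?x z) / Q (?x z)"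
      unfolding fraction_on_def by (elim bexE)
    then show ?thesis
      using h(2) by (intro bexI[of _ P]) auto
  qed
  have generated: "{z \<in> ?S. P (?x z) \<noteq> 0} \<in> ?B" if "P \<in> polynomials (N + n)" for P
    using poly[OF that] by (intro CollectI exI[of _ "\<lambda>z. P (?x z)"] conjI refl)
  have local_fraction: "\<exists>V. openin (zariski (product_space Y n)) V \<and> z \<in> V \<and> fraction_on (N + n) ?x (W \<inter> V) f"
    if W: "openin (zariski (product_space Y n)) W" "W \<subseteq> ?S" "f \<in> regular (product_space Y n) W" "z \<in> W"
    for W f z
  proof -
    from W(3) obtain P Q where PQ: "P \<in> product_functions Y n" "Q \<in> product_functions Y n"
      "\<forall>z\<in>W. Q z \<noteq> 0 \<and> f z = P z / Q z"
      by (auto simp: product_space_def)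
    have "fraction_on (N + n) ?x W (\<lambda>z. P z / Q z)"
      by (rule fraction_on_divide[OF fraction[OF PQ(1) W(2)] fraction[OF PQ(2) W(2)]]) (use PQ(3) in auto)
    then have "fraction_on (N + n) ?x W f"
      by (rule fraction_on_cong) (use PQ(3) in auto)
    then show ?thesis
      using W by (intro exI[of _ W]) simp
  qed
  have regular_fraction: "f \<in> regular (product_space Y n) W" if "fraction_on (N + n) ?x W f" for W f
  proof -
    from that obtain P Q where PQ: "P \<in> polynomials (N + n)" "Q \<in> polynomials (N + n)"
      "\<forall>z\<in>W. Q (?x z) \<noteq> 0 \<and> f z = P (?x z) / Q (?x z)"
      unfolding fraction_on_def by (elim bexE)
    show ?thesis
      unfolding product_space_def ringed_space.select_convs
      by (rule CollectI, rule rev_bexI[OF poly[OF PQ(1)]], rule rev_bexI[OF poly[OF PQ(2)]], rule PQ(3))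
  qed
  show "points (product_space Y n) = ?S" "affine_coordinates (product_space Y n) (N + n) ?x"
    by (rule affine_coordinates_generatedI[OF zariski basic generated local_fraction regular_fraction];
      assumption)+
qed

section \<open>Projective spaces are affine\<close>

text \<open>
  The entries \<open>u\<^sub>i u\<^sub>j\<close> of the matrix \<open>u u\<^sup>T\<close>, listed row by row.
\<close>

definition quadrics :: "nat \<Rightarrow> (nat \<Rightarrow> real) \<Rightarrow> nat \<Rightarrow> real" where
  "quadrics m u = (\<lambda>k. u (k div m) * u (k mod m))"

text \<open>
  A monomial of even degree is a product of products of two variables, and one of odd degree has a
  single variable left over.
\<close>

lemma polynomial_even_odd_parts:
  assumes "F \<in> polynomials m"
  shows "\<exists>E\<in>polynomials (m * m). \<exists>D. (\<forall>i. D i \<in> polynomials (m * m)) \<and>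
      (\<forall>u. F u = E (quadrics m u) + (\<Sum>i<m. u i * D i (quadrics m u)))"
  using assms
proof (induction rule: polynomials_induct)
  case (var i)
  show ?case
    by (intro bexI[of _ "\<lambda>_. 0"] exI[of _ "\<lambda>j _. if j = i then 1 else 0"])
       (use var in \<open>auto intro: polynomials_const simp: if_distrib cong: if_cong\<close>)
next
  case (const c)
  show ?case
    by (intro bexI[of _ "\<lambda>_. c"] exI[of _ "\<lambda>j _. 0"]) (auto intro: polynomials_const)
next
  case (add P Q)
  then obtain E D E' D' where *: "E \<in> polynomials (m * m)" "\<forall>i. D i \<in> polynomials (m * m)"
    "\<forall>u. P u = E (quadrics m u) + (\<Sum>i<m. u i * D i (quadrics m u))"
    "E' \<in> polynomials (m * m)" "\<forall>i. D' i \<in> polynomials (m * m)"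
    "\<forall>u. Q u = E' (quadrics m u) + (\<Sum>i<m. u i * D' i (quadrics m u))"
    by (elim bexE exE conjE)
  show ?case
    by (intro bexI[of _ "\<lambda>z. E z + E' z"] exI[of _ "\<lambda>i z. D i z + D' i z"])
       (use * in \<open>auto intro: polynomials_add simp: sum.distrib distrib_left\<close>)
next
  case (mult P Q)
  then obtain E D E' D' where *: "E \<in> polynomials (m * m)" "\<forall>i. D i \<in> polynomials (m * m)"
    "\<forall>u. P u = E (quadrics m u) + (\<Sum>i<m. u i * D i (quadrics m u))"
    "E' \<in> polynomials (m * m)" "\<forall>i. D' i \<in> polynomials (m * m)"
    "\<forall>u. Q u = E' (quadrics m u) + (\<Sum>i<m. u i * D' i (quadrics m u))"
    by (elim bexE exE conjE)
  \<comment> \<open>the product of two odd parts is even, since \<open>u i * u j\<close> is the coordinate with index \<open>i * m + j\<close>\<close>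
  let ?E = "\<lambda>z. E z * E' z + (\<Sum>i<m. \<Sum>j<m. z (i * m + j) * (D i z * D' j z))"
  let ?D = "\<lambda>i z. E z * D' i z + D i z * E' z"
  have index: "i * m + j < m * m" if "i < m" "j < m" for i j
  proof -
    have "i * m + j < Suc i * m"
      using that by simp
    also have "\<dots> \<le> m * m"
      using that by (intro mult_le_mono1) simp
    finally show ?thesis .
  qed
  have "?E \<in> polynomials (m * m)"
    using * index by (intro polynomials_intros) auto
  moreover have "?D i \<in> polynomials (m * m)" for i
    using * by (intro polynomials_intros) auto
  moreover have "P u * Q u = ?E (quadrics m u) + (\<Sum>i<m. u i * ?D i (quadrics m u))" for u
  proof -
    let ?q = "quadrics m u"
    have "(\<Sum>i<m. u i * D i ?q) * (\<Sum>j<m. u j * D' j ?q) =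
        (\<Sum>i<m. \<Sum>j<m. ?q (i * m + j) * (D i ?q * D' j ?q))"
      unfolding sum_product by (intro sum.cong refl) (simp add: quadrics_def)
    moreover have "(\<Sum>i<m. u i * ?D i ?q) =
        E ?q * (\<Sum>j<m. u j * D' j ?q) + (\<Sum>i<m. u i * D i ?q) * E' ?q"
      by (simp add: sum_distrib_left sum_distrib_right sum.distrib[symmetric] algebra_simps)
    ultimately show ?thesis
      using * by (simp add: algebra_simps)
  qed
  ultimately show ?case
    by (intro bexI[of _ ?E] exI[of _ ?D]) auto
qed

lemma even_polynomial_quadrics:
  assumes "F \<in> polynomials m" "\<And>u. u \<in> Rn m \<Longrightarrow> F (\<lambda>i. - u i) = F u"
  shows "\<exists>E\<in>polynomials (m * m). \<forall>u\<in>Rn m. F u = E (quadrics m u)"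
proof -
  obtain E D where *: "E \<in> polynomials (m * m)"
    "\<forall>u. F u = E (quadrics m u) + (\<Sum>i<m. u i * D i (quadrics m u))"
    using polynomial_even_odd_parts[OF assms(1)] by (elim bexE exE conjE)
  have "F u = E (quadrics m u)" if "u \<in> Rn m" for u
  proof -
    have "quadrics m (\<lambda>i. - u i) = quadrics m u"
      by (simp add: quadrics_def)
    then have "F (\<lambda>i. - u i) = E (quadrics m u) - (\<Sum>i<m. u i * D i (quadrics m u))"
      using *(2)[rule_format, of "\<lambda>i. - u i"] by (simp add: sum_negf)
    then show ?thesis
      using *(2)[rule_format, of u] assms(2)[OF that] by simp
  qed
  with *(1) show ?thesis
    by blast
qed

text \<open>
  A polynomial in the \<open>u\<^sub>i u\<^sub>j\<close> becomes homogeneous of even degree when its terms are multiplied by powers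
  of \<open>\<Sum> u\<^sub>i\<^sup>2\<close>, which are \<open>1\<close> on the unit sphere.
\<close>

lemma homogenization:
  assumes "h \<in> polynomials (m * m)"
  shows "\<exists>k. \<exists>H\<in>homogeneous m (2 * k). \<forall>u. (\<Sum>i<m. (u i)\<^sup>2) = 1 \<longrightarrow> H u = h (quadrics m u)"
  using assms
proof (induction rule: polynomials_induct)
  case (var i)
  then have "i div m < m" "i mod m < m"
    using less_mult_imp_div_less[OF var] by (auto intro: mod_less_divisor gr0I)
  then have "(\<lambda>u. quadrics m u i) \<in> homogeneous m (2 * 1)"
    unfolding quadrics_def homogeneous_def by (auto intro!: polynomials_intros simp: power2_eq_square)
  then show ?case
    by (intro exI[of _ 1] bexI[of _ "\<lambda>u. quadrics m u i"]) auto
next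
  case (const c)
  have "(\<lambda>_. c) \<in> homogeneous m (2 * 0)"
    unfolding homogeneous_def by (auto intro!: polynomials_intros)
  then show ?case
    by (intro exI[of _ 0] bexI[of _ "\<lambda>u. c"]) auto
next
  case (add P Q)
  then obtain k H k' H' where *: "H \<in> homogeneous m (2 * k)" "H' \<in> homogeneous m (2 * k')"
    "\<forall>u. (\<Sum>i<m. (u i)\<^sup>2) = 1 \<longrightarrow> H u = P (quadrics m u)"
    "\<forall>u. (\<Sum>i<m. (u i)\<^sup>2) = 1 \<longrightarrow> H' u = Q (quadrics m u)"
    by (elim bexE exE)
  let ?r = "\<lambda>u::nat \<Rightarrow> real. \<Sum>i<m. (u i)\<^sup>2"
  have "?r (\<lambda>i. t * u i) = t ^ 2 * ?r u" for t u
    by (simp add: power_mult_distrib sum_distrib_left)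
  then have "(\<lambda>u. H u * ?r u ^ k' + H' u * ?r u ^ k) \<in> homogeneous m (2 * (k + k'))"
    using *(1,2) unfolding homogeneous_def
    by (auto intro!: polynomials_intros simp: power_mult_distrib power_mult[symmetric] algebra_simps power_add)
  then show ?case
    using *(3,4) by (intro exI[of _ "k + k'"] bexI[of _ "\<lambda>u. H u * ?r u ^ k' + H' u * ?r u ^ k"]) auto
next
  case (mult P Q)
  then obtain k H k' H' where *: "H \<in> homogeneous m (2 * k)" "H' \<in> homogeneous m (2 * k')"
    "\<forall>u. (\<Sum>i<m. (u i)\<^sup>2) = 1 \<longrightarrow> H u = P (quadrics m u)"
    "\<forall>u. (\<Sum>i<m. (u i)\<^sup>2) = 1 \<longrightarrow> H' u = Q (quadrics m u)"
    by (elim bexE exE)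
  then have "(\<lambda>u. H u * H' u) \<in> homogeneous m (2 * (k + k'))"
    unfolding homogeneous_def by (auto intro!: polynomials_intros simp: power_add algebra_simps)
  then show ?case
    using *(3,4) by (intro exI[of _ "k + k'"] bexI[of _ "\<lambda>u. H u * H' u"]) auto
qed

text \<open>
  A line has exactly two unit vectors, and they differ by a sign, so the choice does not affect the
  quadrics formed from it.
\<close>

definition unit_vector :: "nat \<Rightarrow> (nat \<Rightarrow> real) set \<Rightarrow> nat \<Rightarrow> real" where
  "unit_vector m l = (SOME u. u \<in> l \<and> (\<Sum>i<m. (u i)\<^sup>2) = 1)"

lemma unit_vector:
  assumes "l \<in> proj_points n"
  defines "u \<equiv> unit_vector (Suc n) l"
  shows "u \<in> l" "(\<Sum>i<Suc n. (u i)\<^sup>2) = 1" "u \<in> Rn (Suc n)"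
    and "v \<in> l \<Longrightarrow> \<exists>t. t \<noteq> 0 \<and> v = (\<lambda>i. t * u i)"
proof -
  obtain w where w: "w \<in> Rn (Suc n)" "w \<noteq> (\<lambda>_. 0)" "l = {(\<lambda>i. t * w i) |t. t \<noteq> 0}"
    using assms by (auto simp: proj_points_def proj_point_def)
  define r where "r = (\<Sum>i<Suc n. (w i)\<^sup>2)"
  obtain i where i: "w i \<noteq> 0"
    using w(2) by auto
  then have "i < Suc n"
    using w(1) by (auto simp: Rn_def not_less[symmetric])
  then have "r > 0"
    unfolding r_def using i by (intro sum_pos2[of _ i]) auto
  then have "(\<Sum>i<Suc n. (1 / sqrt r * w i)\<^sup>2) = 1"
    unfolding power_mult_distrib sum_distrib_left[symmetric] r_def[symmetric]
    by (simp add: power_divide)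
  moreover have "(\<lambda>i. 1 / sqrt r * w i) \<in> l"
    unfolding w(3) using \<open>r > 0\<close> by (intro CollectI exI[of _ "1 / sqrt r"]) simp
  ultimately have "\<exists>u. u \<in> l \<and> (\<Sum>i<Suc n. (u i)\<^sup>2) = 1"
    by blast
  from someI_ex[OF this] show u: "u \<in> l" "(\<Sum>i<Suc n. (u i)\<^sup>2) = 1"
    unfolding u_def unit_vector_def by auto
  then show "u \<in> Rn (Suc n)"
    using w(1,3) by (auto simp: Rn_def)
  assume "v \<in> l"
  with u(1) w(3) obtain s t where "s \<noteq> 0" "u = (\<lambda>i. s * w i)" "t \<noteq> 0" "v = (\<lambda>i. t * w i)"
    by auto
  then show "\<exists>t. t \<noteq> 0 \<and> v = (\<lambda>i. t * u i)"
    by (intro exI[of _ "t / s"]) auto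
qed

text \<open>
  The embedding of projective space that sends a line to the orthogonal projection onto it.
\<close>

definition veronese :: "nat \<Rightarrow> (nat \<Rightarrow> real) set \<Rightarrow> nat \<Rightarrow> real" where
  "veronese n l = quadrics (Suc n) (unit_vector (Suc n) l)"

lemma homogeneous_on_line:
  assumes "l \<in> proj_points n" "v \<in> l"
  shows "\<exists>t. t \<noteq> 0 \<and> (\<forall>d. \<forall>F\<in>homogeneous (Suc n) d. F v = t ^ d * F (unit_vector (Suc n) l))"
proof -
  obtain t where "t \<noteq> 0" "v = (\<lambda>i. t * unit_vector (Suc n) l i)"
    using unit_vector(4)[OF assms(1,2)] by auto
  then show ?thesis
    using unit_vector(3)[OF assms(1)] by (auto simp: homogeneous_def)
qed

lemma homogeneous_mult:
  "F \<in> homogeneous n d \<Longrightarrow> G \<in> homogeneous n e \<Longrightarrow> (\<lambda>x. F x * G x) \<in> homogeneous n (d + e)"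
  by (simp add: homogeneous_def polynomials_mult power_add)

lemma homogeneous_even_veronese:
  assumes "F \<in> homogeneous (Suc n) (d + d)"
  shows "\<exists>E\<in>polynomials (Suc n * Suc n). \<forall>l\<in>proj_points n. F (unit_vector (Suc n) l) = E (veronese n l)"
proof -
  have "F (\<lambda>i. - u i) = F u" if "u \<in> Rn (Suc n)" for u
  proof -
    have "F (\<lambda>i. (-1) * u i) = (-1) ^ (d + d) * F u"
      using assms that unfolding homogeneous_def by blast
    then show ?thesis
      by (simp flip: mult_2)
  qed
  then obtain E where "E \<in> polynomials (Suc n * Suc n)" "\<forall>u\<in>Rn (Suc n). F u = E (quadrics (Suc n) u)"
    using even_polynomial_quadrics[of F "Suc n"] assms unfolding homogeneous_def by blast
  then show ?thesis
    using unit_vector(3) unfolding veronese_def by blast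
qed

text \<open>
  Real projective space is affine. On unit vectors, squares of homogeneous polynomials, and products of
  two of the same degree, are even, hence polynomials in the coordinates \<open>u\<^sub>i u\<^sub>j\<close>; thus
  \<open>F \<noteq> 0\<close> and \<open>P / Q\<close> are rewritten as \<open>F\<^sup>2 \<noteq> 0\<close> and \<open>P Q / Q\<^sup>2\<close>. Homogenization leads back.
\<close>

lemma affine_coordinates_proj:
  "affine_coordinates (proj_space n) (Suc n * Suc n) (veronese n)"
proof -
  let ?N = "Suc n * Suc n" and ?x = "veronese n" and ?S = "proj_points n" and ?u = "unit_vector (Suc n)"
  let ?B = "{{l \<in> ?S. \<forall>x\<in>l. F x \<noteq> 0} |F d. F \<in> homogeneous (Suc n) d}"
  have zariski: "zariski (proj_space n) = topology_generated_by ?B"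
    unfolding proj_space_def proj_zariski_def by (rule ringed_space.select_convs)
  have nonzero_iff: "(\<forall>x\<in>l. F x \<noteq> 0) \<longleftrightarrow> F (?u l) \<noteq> 0" if "l \<in> ?S" "F \<in> homogeneous (Suc n) d" for l F d
  proof
    assume "\<forall>x\<in>l. F x \<noteq> 0"
    then show "F (?u l) \<noteq> 0"
      using unit_vector(1)[OF that(1)] by blast
  next
    assume nz: "F (?u l) \<noteq> 0"
    show "\<forall>x\<in>l. F x \<noteq> 0"
    proof
      fix x assume "x \<in> l"
      from homogeneous_on_line[OF that(1) this] obtain t where
        t: "t \<noteq> 0 \<and> (\<forall>d. \<forall>F\<in>homogeneous (Suc n) d. F x = t ^ d * F (?u l))" ..
      from bspec[OF t[THEN conjunct2, THEN spec] that(2)] have "F x = t ^ d * F (?u l)" .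
      then show "F x \<noteq> 0"
        using t nz by simp
    qed
  qed
  have basic: "\<exists>P\<in>polynomials ?N. b = {l \<in> ?S. P (?x l) \<noteq> 0}" if "b \<in> ?B" for b
  proof -
    from that obtain F d where F: "F \<in> homogeneous (Suc n) d" "b = {l \<in> ?S. \<forall>x\<in>l. F x \<noteq> 0}"
      by auto
    from homogeneous_even_veronese[OF homogeneous_mult[OF F(1) F(1)]] obtain E where
      E: "E \<in> polynomials ?N" "\<forall>l\<in>?S. F (?u l) * F (?u l) = E (?x l)" ..
    have "(\<forall>x\<in>l. F x \<noteq> 0) \<longleftrightarrow> E (?x l) \<noteq> 0" if "l \<in> ?S" for l
      unfolding nonzero_iff[OF that F(1)] using E(2) that by (metis mult_eq_0_iff)
    then have "b = {l \<in> ?S. E (?x l) \<noteq> 0}"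
      unfolding F(2) by blast
    with E(1) show ?thesis
      by (intro bexI[of _ E])
  qed
  have generated: "{l \<in> ?S. P (?x l) \<noteq> 0} \<in> ?B" if P: "P \<in> polynomials ?N" for P
  proof -
    from homogenization[OF P] obtain k H where H: "H \<in> homogeneous (Suc n) (2 * k)"
      "\<forall>u. (\<Sum>i<Suc n. (u i)\<^sup>2) = 1 \<longrightarrow> H u = P (quadrics (Suc n) u)"
      by (elim exE bexE)
    have "H (?u l) = P (?x l)" if "l \<in> ?S" for l
      using H(2) unit_vector(2)[OF that] by (simp add: veronese_def del: sum.lessThan_Suc)
    then have "{l \<in> ?S. P (?x l) \<noteq> 0} = {l \<in> ?S. \<forall>x\<in>l. H x \<noteq> 0}"
      using nonzero_iff[OF _ H(1)] by auto
    with H(1) show ?thesis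
      by (intro CollectI exI[of _ H] exI[of _ "2 * k"] conjI)
  qed
  have local_fraction: "\<exists>V. openin (zariski (proj_space n)) V \<and> l \<in> V \<and> fraction_on ?N ?x (U \<inter> V) f"
    if U: "openin (zariski (proj_space n)) U" "U \<subseteq> ?S" "f \<in> regular (proj_space n) U" "l \<in> U"
    for U f l
  proof -
    from U(3,4) obtain W d P Q where W: "openin (zariski (proj_space n)) W" "l \<in> W"
      and PQ: "P \<in> homogeneous (Suc n) d" "Q \<in> homogeneous (Suc n) d"
      "\<forall>m\<in>W \<inter> U. \<forall>x\<in>m. Q x \<noteq> 0 \<and> f m = P x / Q x"
      by (auto simp: proj_space_def)
    from homogeneous_even_veronese[OF homogeneous_mult[OF PQ(1,2)]] obtain A where
      A: "A \<in> polynomials ?N" "\<forall>l\<in>?S. P (?u l) * Q (?u l) = A (?x l)" ..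
    from homogeneous_even_veronese[OF homogeneous_mult[OF PQ(2,2)]] obtain B where
      B: "B \<in> polynomials ?N" "\<forall>l\<in>?S. Q (?u l) * Q (?u l) = B (?x l)" ..
    have "fraction_on ?N ?x (U \<inter> W) f"
    proof (rule fraction_onI[OF A(1) B(1)])
      fix m assume "m \<in> U \<inter> W"
      then have m: "m \<in> ?S" "m \<in> W \<inter> U"
        using U(2) by auto
      then have "Q (?u m) \<noteq> 0 \<and> f m = P (?u m) / Q (?u m)"
        using PQ(3) unit_vector(1) by blast
      then show "B (?x m) \<noteq> 0 \<and> f m = A (?x m) / B (?x m)"
        unfolding A(2)[rule_format, OF m(1), symmetric] B(2)[rule_format, OF m(1), symmetric] by simp
    qed
    with W show ?thesis
      by (intro exI[of _ W]) simp
  qed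
  have regular_fraction: "f \<in> regular (proj_space n) U"
    if U: "openin (zariski (proj_space n)) U" "U \<subseteq> ?S" "fraction_on ?N ?x U f" for U f
  proof -
    from U(3) obtain P Q where PQ: "P \<in> polynomials ?N" "Q \<in> polynomials ?N"
      "\<forall>l\<in>U. Q (?x l) \<noteq> 0 \<and> f l = P (?x l) / Q (?x l)"
      unfolding fraction_on_def by (elim bexE)
    let ?r = "\<lambda>u::nat \<Rightarrow> real. \<Sum>i<Suc n. (u i)\<^sup>2"
    have r: "(\<lambda>u. ?r u ^ k) \<in> homogeneous (Suc n) (2 * k)" for k
    proof -
      have "?r (\<lambda>i. t * u i) = t ^ 2 * ?r u" for t u
        by (simp add: power_mult_distrib sum_distrib_left distrib_left)
      then show ?thesis
        unfolding homogeneous_def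
        by (auto simp del: sum.lessThan_Suc simp: power_mult_distrib power_mult intro!: polynomials_intros)
    qed
    from homogenization[OF PQ(1)] obtain k G where G: "G \<in> homogeneous (Suc n) (2 * k)"
      "\<forall>u. ?r u = 1 \<longrightarrow> G u = P (quadrics (Suc n) u)"
      by (elim exE bexE)
    from homogenization[OF PQ(2)] obtain j H where H: "H \<in> homogeneous (Suc n) (2 * j)"
      "\<forall>u. ?r u = 1 \<longrightarrow> H u = Q (quadrics (Suc n) u)"
      by (elim exE bexE)
    let ?G = "\<lambda>u. G u * ?r u ^ j" and ?H = "\<lambda>u. H u * ?r u ^ k" and ?d = "2 * k + 2 * j"
    have GH: "?G \<in> homogeneous (Suc n) ?d" "?H \<in> homogeneous (Suc n) ?d"
      using homogeneous_mult[OF G(1) r[of j]] homogeneous_mult[OF H(1) r[of k]]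
      by (simp_all add: add.commute del: sum.lessThan_Suc)
    have "\<forall>m\<in>U. \<forall>x\<in>m. ?H x \<noteq> 0 \<and> f m = ?G x / ?H x"
    proof (intro ballI)
      fix m x assume m: "m \<in> U" "x \<in> m"
      with U(2) have mS: "m \<in> ?S"
        by auto
      have u: "?G (?u m) = P (?x m)" "?H (?u m) = Q (?x m)"
        using G(2) H(2) unit_vector(2)[OF mS] by (simp_all add: veronese_def del: sum.lessThan_Suc)
      from homogeneous_on_line[OF mS m(2)] obtain t where
        t': "t \<noteq> 0 \<and> (\<forall>d. \<forall>F\<in>homogeneous (Suc n) d. F x = t ^ d * F (?u m))" ..
      have t: "t \<noteq> 0" "?G x = t ^ ?d * ?G (?u m)" "?H x = t ^ ?d * ?H (?u m)"
        using t' bspec[OF t'[THEN conjunct2, THEN spec] GH(1)]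
          bspec[OF t'[THEN conjunct2, THEN spec] GH(2)] by blast+
      show "?H x \<noteq> 0 \<and> f m = ?G x / ?H x"
        unfolding t(2,3) u using t(1) PQ(3) m(1) by simp
    qed
    moreover have "openin (proj_zariski n) U"
      using U(1) by (simp add: proj_space_def)
    ultimately show ?thesis
      using GH unfolding proj_space_def ringed_space.simps
      by (intro CollectI ballI exI[of _ U] exI[of _ ?d] exI[of _ ?G] exI[of _ ?H] conjI) auto
  qed
  show ?thesis
    by (rule affine_coordinates_generatedI(2)[OF zariski basic generated local_fraction regular_fraction];
      assumption)
qed

lemma variety_affine_coordinates:
  assumes "real_algebraic_variety X"
  obtains N x where "affine_coordinates X N x"
  using assms affine_coordinates_iso[OF _ affine_coordinates_induced[OF affine_coordinates_proj]]
  unfolding real_algebraic_variety_def by blast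

section \<open>Tangent vectors and curves\<close>

lemma regular_atI:
  assumes X: "affine_coordinates X N x" and p: "p \<in> points X" and f: "fraction_on N x (points X) f"
  shows "f \<in> regular_at X p"
proof -
  have "openin (zariski X) (points X)"
    by (rule openin_topspace)
  then show ?thesis
    using p f regular_affine[OF X] unfolding regular_at_def by blast
qed

lemma regular_atE:
  assumes X: "affine_coordinates X N x" and f: "f \<in> regular_at X p"
  obtains P Q V where "P \<in> polynomials N" "Q \<in> polynomials N" "openin (zariski X) V" "p \<in> V"
    "\<forall>q\<in>V. Q (x q) \<noteq> 0 \<and> f q = P (x q) / Q (x q)"
proof -
  from f obtain V where V: "openin (zariski X) V" "p \<in> V" "f \<in> regular X V"
    unfolding regular_at_def by auto
  from V(3) have "fraction_on N x V f"
    unfolding regular_affine[OF X V(1)] .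
  then show thesis
    unfolding fraction_on_def using V that by (elim bexE)
qed

lemma regular_at_add_mult:
  assumes X: "affine_coordinates X N x" and "f \<in> regular_at X p" "g \<in> regular_at X p"
  shows "(\<lambda>q. f q + g q) \<in> regular_at X p" "(\<lambda>q. f q * g q) \<in> regular_at X p"
proof -
  from assms obtain V W where V: "openin (zariski X) V" "p \<in> V" "f \<in> regular X V"
    and W: "openin (zariski X) W" "p \<in> W" "g \<in> regular X W"
    unfolding regular_at_def by auto
  have VW: "openin (zariski X) (V \<inter> W)" "p \<in> V \<inter> W"
    using V W by auto
  have "fraction_on N x (V \<inter> W) f"
    using V(3) unfolding regular_affine[OF X V(1)] by (rule fraction_on_subset) auto
  moreover have "fraction_on N x (V \<inter> W) g"
    using W(3) unfolding regular_affine[OF X W(1)] by (rule fraction_on_subset) auto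
  ultimately have "(\<lambda>q. f q + g q) \<in> regular X (V \<inter> W)" "(\<lambda>q. f q * g q) \<in> regular X (V \<inter> W)"
    unfolding regular_affine[OF X VW(1)] by (rule fraction_on_add, rule fraction_on_mult)
  with VW show "(\<lambda>q. f q + g q) \<in> regular_at X p" "(\<lambda>q. f q * g q) \<in> regular_at X p"
    unfolding regular_at_def by blast+
qed

lemma tangent_vectorD:
  assumes "tangent_vector X p D" "f \<in> regular_at X p" "g \<in> regular_at X p"
  shows "germ_eq X p f g \<Longrightarrow> D f = D g"
    and "D (\<lambda>q. f q + g q) = D f + D g"
    and "D (\<lambda>q. f q * g q) = f p * D g + g p * D f"
    and "D (\<lambda>q. c * f q) = c * D f"
  using assms unfolding tangent_vector_def by auto

lemma tangent_vector_const:
  assumes X: "affine_coordinates X N x" and p: "p \<in> points X" and D: "tangent_vector X p D"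
  shows "D (\<lambda>_. c) = 0"
proof -
  have one: "(\<lambda>_. 1) \<in> regular_at X p"
    by (rule regular_atI[OF X p fraction_on_const])
  have "D (\<lambda>_. 1) = 0"
    using tangent_vectorD(3)[OF D one one] by simp
  then show ?thesis
    using tangent_vectorD(4)[OF D one one, of c] by simp
qed

text \<open>
  A derivation acts on polynomial expressions in functions \<open>c\<^sub>i\<close> by the chain rule, exactly as
  differentiation along a curve whose velocity has the components \<open>D c\<^sub>i\<close>.
\<close>

lemma tangent_vector_poly:
  assumes X: "affine_coordinates X N x" and p: "p \<in> points X" and D: "tangent_vector X p D"
    and c: "\<And>i. i < m \<Longrightarrow> (\<lambda>q. c q i) \<in> regular_at X p"
    and \<gamma>: "\<And>i. i < m \<Longrightarrow> \<gamma> 0 i = c p i"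
      "\<And>i. i < m \<Longrightarrow> ((\<lambda>t. \<gamma> t i) has_real_derivative D (\<lambda>q. c q i)) (at 0)"
    and P: "P \<in> polynomials m"
  shows "(\<lambda>q. P (c q)) \<in> regular_at X p \<and> P (\<gamma> 0) = P (c p) \<and>
    ((\<lambda>t. P (\<gamma> t)) has_real_derivative D (\<lambda>q. P (c q))) (at 0)"
  using P
proof (induction rule: polynomials_induct)
  case (var i)
  then show ?case
    using c \<gamma> by simp
next
  case (const a)
  show ?case
    using regular_atI[OF X p fraction_on_const] tangent_vector_const[OF X p D] by simp
next
  case (add P Q)
  then have P: "(\<lambda>q. P (c q)) \<in> regular_at X p" and Q: "(\<lambda>q. Q (c q)) \<in> regular_at X p"
    and dP: "((\<lambda>t. P (\<gamma> t)) has_real_derivative D (\<lambda>q. P (c q))) (at 0)"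
    and dQ: "((\<lambda>t. Q (\<gamma> t)) has_real_derivative D (\<lambda>q. Q (c q))) (at 0)"
    by auto
  from DERIV_add[OF dP dQ] show ?case
    using regular_at_add_mult(1)[OF X P Q] tangent_vectorD(2)[OF D P Q] add by simp
next
  case (mult P Q)
  then have P: "(\<lambda>q. P (c q)) \<in> regular_at X p" and Q: "(\<lambda>q. Q (c q)) \<in> regular_at X p"
    and dP: "((\<lambda>t. P (\<gamma> t)) has_real_derivative D (\<lambda>q. P (c q))) (at 0)"
    and dQ: "((\<lambda>t. Q (\<gamma> t)) has_real_derivative D (\<lambda>q. Q (c q))) (at 0)"
    by auto
  from DERIV_mult[OF dP dQ] show ?case
    using regular_at_add_mult(2)[OF X P Q] tangent_vectorD(3)[OF D P Q] mult by (simp add: ac_simps)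
qed

text \<open>
  For \<open>g = P / Q\<close> the value \<open>D g\<close> is determined by the product rule applied to \<open>g Q = P\<close>.
\<close>

lemma tangent_vector_fraction:
  assumes X: "affine_coordinates X N x" and p: "p \<in> points X" and D: "tangent_vector X p D"
    and c: "\<And>i. i < m \<Longrightarrow> (\<lambda>q. c q i) \<in> regular_at X p"
    and \<gamma>: "\<And>i. i < m \<Longrightarrow> \<gamma> 0 i = c p i"
      "\<And>i. i < m \<Longrightarrow> ((\<lambda>t. \<gamma> t i) has_real_derivative D (\<lambda>q. c q i)) (at 0)"
    and PQ: "P \<in> polynomials m" "Q \<in> polynomials m"
    and g: "g \<in> regular_at X p"
    and V: "openin (zariski X) V" "p \<in> V" "\<forall>q\<in>V. Q (c q) \<noteq> 0 \<and> g q = P (c q) / Q (c q)"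
  shows "((\<lambda>t. P (\<gamma> t) / Q (\<gamma> t)) has_real_derivative D g) (at 0)"
proof -
  note poly = tangent_vector_poly[where m = m and c = c and \<gamma> = \<gamma>, OF X p D c \<gamma>]
  note P = poly[OF _ _ _ PQ(1)] and Q = poly[OF _ _ _ PQ(2)]
  have Pr: "(\<lambda>q. P (c q)) \<in> regular_at X p" and Qr: "(\<lambda>q. Q (c q)) \<in> regular_at X p"
    using P Q by auto
  have nz: "Q (c p) \<noteq> 0" and gp: "g p = P (c p) / Q (c p)"
    using V by auto
  have "germ_eq X p (\<lambda>q. P (c q)) (\<lambda>q. g q * Q (c q))"
    unfolding germ_eq_def using V by (intro exI[of _ V]) auto
  then have DP: "D (\<lambda>q. P (c q)) = D (\<lambda>q. g q * Q (c q))"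
    by (rule tangent_vectorD(1)[OF D Pr regular_at_add_mult(2)[OF X g Qr]])
  have eq: "P (\<gamma> 0) = P (c p)" "Q (\<gamma> 0) = Q (c p)"
    using P Q by auto
  have "((\<lambda>t. P (\<gamma> t) / Q (\<gamma> t)) has_real_derivative
      (D (\<lambda>q. P (c q)) * Q (\<gamma> 0) - P (\<gamma> 0) * D (\<lambda>q. Q (c q))) / (Q (\<gamma> 0) * Q (\<gamma> 0))) (at 0)"
    using P Q nz eq by (intro DERIV_divide) auto
  moreover have "(D (\<lambda>q. P (c q)) * Q (\<gamma> 0) - P (\<gamma> 0) * D (\<lambda>q. Q (c q))) / (Q (\<gamma> 0) * Q (\<gamma> 0)) = D g"
    unfolding DP tangent_vectorD(3)[OF D g Qr] gp eq using nz by (simp add: field_simps)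
  ultimately show ?thesis
    by simp
qed

lemma polynomial_curve_differentiable:
  assumes "P \<in> polynomials m" "\<And>i. i < m \<Longrightarrow> \<exists>d. ((\<lambda>t. \<gamma> t i) has_real_derivative d) (at 0)"
  shows "\<exists>d. ((\<lambda>t. P (\<gamma> t)) has_real_derivative d) (at 0)"
  using assms(1)
proof (induction rule: polynomials_induct)
  case (var i)
  then show ?case by (rule assms(2))
next
  case (const a)
  show ?case by (auto intro: DERIV_const)
next
  case (add P Q)
  then show ?case by (auto intro: DERIV_add)
next
  case (mult P Q)
  then show ?case by (auto intro: DERIV_mult)
qed

lemma DERIV_eventually_eq:
  fixes f :: "real \<Rightarrow> real"
  assumes "(g has_real_derivative d) (at a)" "\<forall>\<^sub>F t in nhds a. f t = g t"
  shows "(f has_real_derivative d) (at a)"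
  using assms DERIV_cong_ev[of a a f g d d] by simp

text \<open>
  Differentiable curves are continuous for the Zariski topology at the given point, since polynomials in
  their coordinates are continuous in the parameter.
\<close>

lemma curve_eventually:
  assumes X: "affine_coordinates X N x" and V: "openin (zariski X) V" "c 0 \<in> V"
    and c: "\<And>t. c t \<in> points X" "\<And>i. i < N \<Longrightarrow> \<exists>d. ((\<lambda>t. x (c t) i) has_real_derivative d) (at 0)"
  shows "\<forall>\<^sub>F t in nhds (0::real). c t \<in> V"
proof -
  from V(1) X obtain R where R: "R \<in> polynomials N" "V = {q \<in> points X. R (x q) \<noteq> 0}"
    by (auto simp: openin_affine)
  from polynomial_curve_differentiable[where \<gamma> = "\<lambda>t. x (c t)", OF R(1) c(2)]
  obtain d where "((\<lambda>t. R (x (c t))) has_real_derivative d) (at 0)" ..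
  then have "isCont (\<lambda>t. R (x (c t))) 0"
    by (rule DERIV_isCont)
  moreover have nz: "R (x (c 0)) \<noteq> 0"
    using V(2) R(2) by simp
  ultimately have "\<forall>\<^sub>F t in at 0. R (x (c t)) \<noteq> 0"
    unfolding isCont_def by (rule tendsto_imp_eventually_ne)
  then have "\<forall>\<^sub>F t in nhds 0. R (x (c t)) \<noteq> 0"
    using nz by (simp add: eventually_nhds_conv_at)
  then show ?thesis
    by (rule eventually_mono) (simp add: R(2) c(1))
qed

lemma regular_curve_differentiable:
  assumes X: "affine_coordinates X N x" and f: "f \<in> regular_at X (c 0)"
    and c: "\<And>t. c t \<in> points X" "\<And>i. i < N \<Longrightarrow> \<exists>d. ((\<lambda>t. x (c t) i) has_real_derivative d) (at 0)"
  shows "\<exists>d. ((\<lambda>t. f (c t)) has_real_derivative d) (at (0::real))"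
proof -
  obtain P Q V where PQ: "P \<in> polynomials N" "Q \<in> polynomials N"
    and V: "openin (zariski X) V" "c 0 \<in> V" "\<forall>q\<in>V. Q (x q) \<noteq> 0 \<and> f q = P (x q) / Q (x q)"
    using regular_atE[OF X f] .
  note poly = polynomial_curve_differentiable[where \<gamma> = "\<lambda>t. x (c t)", OF _ c(2)]
  from poly[OF PQ(1)] poly[OF PQ(2)] obtain a b where "((\<lambda>t. P (x (c t))) has_real_derivative a) (at 0)"
    "((\<lambda>t. Q (x (c t))) has_real_derivative b) (at 0)"
    by blast
  then have "((\<lambda>t. P (x (c t)) / Q (x (c t))) has_real_derivative
      (a * Q (x (c 0)) - P (x (c 0)) * b) / (Q (x (c 0)) * Q (x (c 0)))) (at 0)"
    using V(2,3) by (intro DERIV_divide) auto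
  moreover have "\<forall>\<^sub>F t in nhds 0. f (c t) = P (x (c t)) / Q (x (c t))"
    using curve_eventually[where c = c, OF X V(1,2) c] by (rule eventually_mono) (use V(3) in auto)
  ultimately show ?thesis
    by (blast intro: DERIV_eventually_eq)
qed

text \<open>
  A tangent vector that agrees with the velocity of a curve on the coordinates agrees with it on all
  regular functions. This turns questions about derivations into questions about derivatives.
\<close>

lemma regular_curve_derivative:
  assumes X: "affine_coordinates X N x" and D: "tangent_vector X (c 0) D" and f: "f \<in> regular_at X (c 0)"
    and c: "\<And>t. c t \<in> points X"
      "\<And>i. i < N \<Longrightarrow> ((\<lambda>t. x (c t) i) has_real_derivative D (\<lambda>q. x q i)) (at 0)"
  shows "((\<lambda>t. f (c t)) has_real_derivative D f) (at (0::real))"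
proof -
  obtain P Q V where PQ: "P \<in> polynomials N" "Q \<in> polynomials N"
    and V: "openin (zariski X) V" "c 0 \<in> V" "\<forall>q\<in>V. Q (x q) \<noteq> 0 \<and> f q = P (x q) / Q (x q)"
    using regular_atE[OF X f] .
  have "(\<lambda>q. x q i) \<in> regular_at X (c 0)" if "i < N" for i
    by (rule regular_atI[OF X c(1) fraction_on_coordinate[OF that]])
  then have "((\<lambda>t. P (x (c t)) / Q (x (c t))) has_real_derivative D f) (at 0)"
    by (rule tangent_vector_fraction[where \<gamma> = "\<lambda>t. x (c t)" and c = x and m = N,
          OF X c(1) D _ refl c(2) PQ f V])
  moreover have "\<forall>\<^sub>F t in nhds 0. f (c t) = P (x (c t)) / Q (x (c t))"
  proof (rule eventually_mono)
    show "\<forall>\<^sub>F t in nhds 0. c t \<in> V"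
      by (rule curve_eventually[where c = c, OF X V(1,2) c(1)]) (use c(2) in blast)+
  qed (use V(3) in auto)
  ultimately show ?thesis
    by (rule DERIV_eventually_eq)
qed

lemma tangent_vector_induced_open:
  assumes Y: "affine_coordinates Y N x" and U: "openin (zariski Y) U" and D: "tangent_vector Y y D"
  shows "tangent_vector (induced_space Y U) y D"
proof -
  have open_iff: "openin (zariski (induced_space Y U)) V \<Longrightarrow> openin (zariski Y) V" for V
    using openin_open_subtopology[OF U] by (simp add: induced_space_def)
  have "f \<in> regular_at Y y" if "f \<in> regular_at (induced_space Y U) y" for f
  proof -
    from that obtain V where V: "openin (zariski (induced_space Y U)) V" "y \<in> V" "f \<in> regular (induced_space Y U) V"
      unfolding regular_at_def by auto
    from V(3) have "f \<in> regular Y V"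
      unfolding regular_affine[OF affine_coordinates_induced[OF Y] V(1)] regular_affine[OF Y open_iff[OF V(1)]] .
    then show ?thesis
      using V open_iff unfolding regular_at_def by auto
  qed
  moreover have "germ_eq Y y f g" if "germ_eq (induced_space Y U) y f g" for f g
    using that open_iff unfolding germ_eq_def by auto
  ultimately show ?thesis
    using D unfolding tangent_vector_def by simp
qed

section \<open>Sprays on product bundles\<close>

text \<open>
  A spray on the product bundle \<open>W \<times> \<real>\<^sup>k\<close> over a subset \<open>W\<close>, with values anywhere in \<open>Y\<close> rather than in \<open>W\<close>.
  This freedom allows restricting the base to a set over which a bundle is trivial.
\<close>

definition spray_over ::
    "'a ringed_space \<Rightarrow> nat \<Rightarrow> ('a \<Rightarrow> nat \<Rightarrow> real) \<Rightarrow> 'a set \<Rightarrow> nat \<Rightarrow> ('a \<times> (nat \<Rightarrow> real) \<Rightarrow> 'a) \<Rightarrow> bool" where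
  "spray_over Y N x W k s \<longleftrightarrow>
     (\<forall>z\<in>W \<times> Rn k. s z \<in> points Y) \<and>
     (\<forall>j<N. fraction_on (N + k) (product_coordinates N x) (W \<times> Rn k) (\<lambda>z. x (s z) j)) \<and>
     (\<forall>y\<in>W. s (y, \<lambda>_. 0) = y)"

text \<open>
  Surjectivity of the differential of \<open>v \<mapsto> s (y, v)\<close> at the origin: every tangent vector is the velocity
  of the image of a line through the origin.
\<close>

definition dominating_at ::
    "'a ringed_space \<Rightarrow> nat \<Rightarrow> ('a \<Rightarrow> nat \<Rightarrow> real) \<Rightarrow> nat \<Rightarrow> ('a \<times> (nat \<Rightarrow> real) \<Rightarrow> 'a) \<Rightarrow> 'a \<Rightarrow> bool" where
  "dominating_at Y N x k s y \<longleftrightarrow>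
     (\<forall>D. tangent_vector Y y D \<longrightarrow> (\<exists>w\<in>Rn k. \<forall>j<N.
        ((\<lambda>t. x (s (y, \<lambda>i. t * w i)) j) has_real_derivative D (\<lambda>p. x p j)) (at 0)))"

lemma zero_in_Rn: "(\<lambda>_. 0) \<in> Rn k"
  by (simp add: Rn_def)

lemma scale_in_Rn: "w \<in> Rn k \<Longrightarrow> (\<lambda>i. t * w i) \<in> Rn k"
  by (simp add: Rn_def)

text \<open>
  The composite \<open>s2 (s1 (y, u), v)\<close> restricts to \<open>s1\<close> for \<open>v = 0\<close> and to \<open>s2\<close> for \<open>u = 0\<close>. Hence its
  differential is surjective wherever that of \<open>s1\<close> or of \<open>s2\<close> is.
\<close>

lemma spray_over_compose:
  assumes s1: "spray_over Y N x (points Y) a s1" and s2: "spray_over Y N x (points Y) b s2"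
  obtains s where "spray_over Y N x (points Y) (a + b) s"
    "\<And>y. y \<in> points Y \<Longrightarrow> dominating_at Y N x a s1 y \<or> dominating_at Y N x b s2 y \<Longrightarrow> dominating_at Y N x (a + b) s y"
proof -
  define fst_part where "fst_part v = (\<lambda>i. if i < a then v i else 0)" for v :: "nat \<Rightarrow> real"
  define snd_part where "snd_part v = (\<lambda>i. v (i + a))" for v :: "nat \<Rightarrow> real"
  define s where "s = (\<lambda>z. s2 (s1 (fst z, fst_part (snd z)), snd_part (snd z)))"
  let ?x = "product_coordinates N x" and ?S = "points Y \<times> Rn (a + b)"
  have parts: "fst_part v \<in> Rn a" "v \<in> Rn (a + b) \<Longrightarrow> snd_part v \<in> Rn b" for v
    by (auto simp: Rn_def fst_part_def snd_part_def)
  have s1_maps: "s1 (fst z, fst_part (snd z)) \<in> points Y" if "z \<in> ?S" for z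
    using s1 that parts by (auto simp: spray_over_def)
  have coordinate: "fraction_on (N + (a + b)) ?x ?S (\<lambda>z. x (fst z) i)" if "i < N" for i
    by (rule fraction_on_base[OF fraction_on_coordinate[OF that, of x "points Y"]]) auto
  have s1_fraction: "fraction_on (N + (a + b)) ?x ?S (\<lambda>z. x (s1 (fst z, fst_part (snd z))) j)" if "j < N" for j
  proof (rule fraction_on_compose[where g = "\<lambda>z. x (s1 z) j" and \<phi> = "\<lambda>z. (fst z, fst_part (snd z))"
        and V = "points Y \<times> Rn a" and y = ?x and n = "N + a"])
    show "fraction_on (N + a) ?x (points Y \<times> Rn a) (\<lambda>z. x (s1 z) j)"
      using s1 that by (simp add: spray_over_def)
    show "(fst z, fst_part (snd z)) \<in> points Y \<times> Rn a" if "z \<in> ?S" for z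
      using that parts by auto
    fix i assume i: "i < N + a"
    show "fraction_on (N + (a + b)) ?x ?S (\<lambda>z. ?x (fst z, fst_part (snd z)) i)"
    proof (cases "i < N")
      case True
      then show ?thesis
        using coordinate by (simp add: product_coordinates_def join_def)
    next
      case False
      then have "(\<lambda>z. ?x (fst z, fst_part (snd z)) i) = (\<lambda>z. snd z (i - N))"
        using i by (auto simp: product_coordinates_def join_def fst_part_def)
      then show ?thesis
        using fraction_on_fibre_coordinate[of "i - N" "a + b" N x ?S] False i by simp
    qed
  qed
  have "fraction_on (N + (a + b)) ?x ?S (\<lambda>z. x (s z) j)" if "j < N" for j
    unfolding s_def
  proof (rule fraction_on_compose[where g = "\<lambda>z. x (s2 z) j"
        and \<phi> = "\<lambda>z. (s1 (fst z, fst_part (snd z)), snd_part (snd z))"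
        and V = "points Y \<times> Rn b" and y = ?x and n = "N + b"])
    show "fraction_on (N + b) ?x (points Y \<times> Rn b) (\<lambda>z. x (s2 z) j)"
      using s2 that by (simp add: spray_over_def)
    show "(s1 (fst z, fst_part (snd z)), snd_part (snd z)) \<in> points Y \<times> Rn b" if "z \<in> ?S" for z
      using s1_maps[OF that] that parts(2) by auto
    fix i assume i: "i < N + b"
    show "fraction_on (N + (a + b)) ?x ?S (\<lambda>z. ?x (s1 (fst z, fst_part (snd z)), snd_part (snd z)) i)"
    proof (cases "i < N")
      case True
      then show ?thesis
        using s1_fraction by (simp add: product_coordinates_def join_def)
    next
      case False
      then have "(\<lambda>z. ?x (s1 (fst z, fst_part (snd z)), snd_part (snd z)) i) = (\<lambda>z. snd z (i - N + a))"
        by (auto simp: product_coordinates_def join_def snd_part_def)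
      then show ?thesis
        using fraction_on_fibre_coordinate[of "i - N + a" "a + b" N x ?S] False i by simp
    qed
  qed
  moreover have "s z \<in> points Y" if "z \<in> ?S" for z
    using s2 s1_maps[OF that] that parts(2) by (auto simp: spray_over_def s_def)
  moreover have zero_parts: "fst_part (\<lambda>_. 0) = (\<lambda>_. 0)" "snd_part (\<lambda>_. 0) = (\<lambda>_. 0)"
    by (auto simp: fst_part_def snd_part_def)
  then have "s (y, \<lambda>_. 0) = y" if "y \<in> points Y" for y
    using s1 s2 that by (simp add: spray_over_def s_def)
  ultimately have "spray_over Y N x (points Y) (a + b) s"
    unfolding spray_over_def by blast
  moreover have "dominating_at Y N x (a + b) s y"
    if y: "y \<in> points Y" and dom: "dominating_at Y N x a s1 y \<or> dominating_at Y N x b s2 y" for y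
    unfolding dominating_at_def
  proof (intro allI impI)
    fix D assume D: "tangent_vector Y y D"
    from dom show "\<exists>w\<in>Rn (a + b). \<forall>j<N.
        ((\<lambda>t. x (s (y, \<lambda>i. t * w i)) j) has_real_derivative D (\<lambda>p. x p j)) (at 0)"
    proof
      assume "dominating_at Y N x a s1 y"
      with D obtain w where w: "w \<in> Rn a"
        "\<forall>j<N. ((\<lambda>t. x (s1 (y, \<lambda>i. t * w i)) j) has_real_derivative D (\<lambda>p. x p j)) (at 0)"
        unfolding dominating_at_def by blast
      have "fst_part (\<lambda>i. t * w i) = (\<lambda>i. t * w i)" "snd_part (\<lambda>i. t * w i) = (\<lambda>_. 0)" for t
        using w(1) by (auto simp: fst_part_def snd_part_def Rn_def)
      moreover have "s1 (y, \<lambda>i. t * w i) \<in> points Y" for t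
        using s1 y scale_in_Rn[OF w(1)] by (auto simp: spray_over_def)
      ultimately have "s (y, \<lambda>i. t * w i) = s1 (y, \<lambda>i. t * w i)" for t
        using s2 by (simp add: s_def spray_over_def)
      then show ?thesis
        using w by (intro bexI[of _ w]) (auto simp: Rn_def)
    next
      assume "dominating_at Y N x b s2 y"
      with D obtain w where w: "w \<in> Rn b"
        "\<forall>j<N. ((\<lambda>t. x (s2 (y, \<lambda>i. t * w i)) j) has_real_derivative D (\<lambda>p. x p j)) (at 0)"
        unfolding dominating_at_def by blast
      \<comment> \<open>the direction \<open>w\<close> in the second factor\<close>
      let ?w = "\<lambda>i. if i < a then 0 else w (i - a)"
      have "fst_part (\<lambda>i. t * ?w i) = (\<lambda>_. 0)" "snd_part (\<lambda>i. t * ?w i) = (\<lambda>i. t * w i)" for t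
        by (auto simp: fst_part_def snd_part_def)
      then have "s (y, \<lambda>i. t * ?w i) = s2 (y, \<lambda>i. t * w i)" for t
        using s1 y by (simp add: s_def spray_over_def)
      moreover have "?w \<in> Rn (a + b)"
        using w(1) by (auto simp: Rn_def)
      ultimately show ?thesis
        using w(2) by (intro bexI[of _ ?w]) auto
    qed
  qed
  ultimately show thesis
    by (rule that)
qed

section \<open>Extension of sprays to the whole variety\<close>

lemma polynomials_cong:
  assumes "P \<in> polynomials n" "\<And>i. i < n \<Longrightarrow> u i = v i"
  shows "P u = P v"
  using assms(1) by (induction rule: polynomials_induct) (simp_all add: assms(2))

definition scale_fibre :: "nat \<Rightarrow> real \<Rightarrow> (nat \<Rightarrow> real) \<Rightarrow> nat \<Rightarrow> real" where
  "scale_fibre N t z = (\<lambda>i. if i < N then z i else t * z i)"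

lemma scale_fibre_product_coordinates:
  "scale_fibre N t (product_coordinates N x (y, v)) = product_coordinates N x (y, \<lambda>i. t * v i)"
  by (auto simp: scale_fibre_def product_coordinates_def join_def)

lemma polynomials_scale_fibre:
  assumes "F \<in> polynomials m" "\<rho> \<in> polynomials m"
  shows "(\<lambda>z. F (scale_fibre N (\<rho> z) z)) \<in> polynomials m"
proof (rule polynomials_subst[OF assms(1)])
  fix i assume "i < m"
  then show "(\<lambda>z. scale_fibre N (\<rho> z) z i) \<in> polynomials m"
    using assms(2) by (cases "i < N") (auto simp: scale_fibre_def intro: polynomials_intros)
qed

text \<open>
  Taylor expansion of first order in the factor by which the fibre coordinates are scaled.
\<close>

lemma polynomial_scale_fibre_expansion:
  assumes F: "F \<in> polynomials m" and \<rho>: "\<rho> \<in> polynomials m"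
  shows "\<exists>G\<in>polynomials m. \<forall>z. F (scale_fibre N (\<rho> z) z) = F (scale_fibre N 0 z) + \<rho> z * G z"
  using F
proof (induction rule: polynomials_induct)
  case (var i)
  show ?case
  proof (cases "i < N")
    case True
    then show ?thesis
      by (intro bexI[of _ "\<lambda>_. 0"]) (auto simp: scale_fibre_def intro: polynomials_intros)
  next
    case False
    then show ?thesis
      using var by (intro bexI[of _ "\<lambda>z. z i"]) (auto simp: scale_fibre_def intro: polynomials_intros)
  qed
next
  case (const c)
  show ?case
    by (intro bexI[of _ "\<lambda>_. 0"]) (auto intro: polynomials_intros)
next
  case (add P Q)
  then obtain G H where "G \<in> polynomials m" "H \<in> polynomials m"
    "\<forall>z. P (scale_fibre N (\<rho> z) z) = P (scale_fibre N 0 z) + \<rho> z * G z"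
    "\<forall>z. Q (scale_fibre N (\<rho> z) z) = Q (scale_fibre N 0 z) + \<rho> z * H z"
    by (elim bexE)
  then show ?case
    by (intro bexI[of _ "\<lambda>z. G z + H z"]) (auto intro: polynomials_intros simp: algebra_simps)
next
  case (mult P Q)
  then obtain G H where GH: "G \<in> polynomials m" "H \<in> polynomials m"
    "\<forall>z. P (scale_fibre N (\<rho> z) z) = P (scale_fibre N 0 z) + \<rho> z * G z"
    "\<forall>z. Q (scale_fibre N (\<rho> z) z) = Q (scale_fibre N 0 z) + \<rho> z * H z"
    by (elim bexE)
  let ?G = "\<lambda>z. P (scale_fibre N 0 z) * H z + G z * Q (scale_fibre N 0 z) + \<rho> z * (G z * H z)"
  have "?G \<in> polynomials m"
    using mult(1,2) GH(1,2) \<rho> by (intro polynomials_intros polynomials_scale_fibre)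
  moreover have "\<forall>z. P (scale_fibre N (\<rho> z) z) * Q (scale_fibre N (\<rho> z) z) =
      P (scale_fibre N 0 z) * Q (scale_fibre N 0 z) + \<rho> z * ?G z"
    using GH(3,4) by (simp add: algebra_simps)
  ultimately show ?case
    by (intro bexI[of _ ?G])
qed

text \<open>
  Extension of a spray \<open>\<sigma>\<close> across the complement of \<open>W\<close>, by slowing it down near the boundary. Write the
  coordinates as \<open>x\<^sub>j (\<sigma> (y, v)) = P\<^sub>j / Q\<^sub>j\<close>, let \<open>q\<^sub>j y = Q\<^sub>j (y, 0)\<close> and \<open>W = {h \<noteq> 0}\<close>, and put
  \<open>\<rho> = h \<Prod> q\<^sub>j\<close> and \<open>e\<^sub>j = \<rho> / q\<^sub>j\<close>, both polynomials. Expanding at \<open>v = 0\<close>,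
  where \<open>P\<^sub>j - x\<^sub>j Q\<^sub>j\<close> vanishes, gives
  \<open>Q\<^sub>j (y, \<rho> v) = q\<^sub>j (1 + e\<^sub>j G\<^sub>j)\<close> and \<open>(P\<^sub>j - x\<^sub>j Q\<^sub>j) (y, \<rho> v) = q\<^sub>j e\<^sub>j H\<^sub>j\<close>, so the \<open>q\<^sub>j\<close>
  cancel and
  \<open>x\<^sub>j (\<sigma> (y, \<rho> v)) = x\<^sub>j + e\<^sub>j H\<^sub>j / (1 + e\<^sub>j G\<^sub>j)\<close>. Off \<open>W\<close> the factor \<open>e\<^sub>j\<close> vanishes, the
  denominator is \<open>1\<close>, and the formula describes the constant map \<open>v \<mapsto> y\<close>. On \<open>W\<close> the factor \<open>\<rho>\<close> is
  nonzero, so the image of the differential is unchanged.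
\<close>

lemma spray_over_extend:
  assumes Y: "affine_coordinates Y N x" and W: "openin (zariski Y) W"
    and \<sigma>: "spray_over Y N x W k \<sigma>"
  obtains s where "spray_over Y N x (points Y) k s"
    "\<And>y. y \<in> W \<Longrightarrow> dominating_at Y N x k \<sigma> y \<Longrightarrow> dominating_at Y N x k s y"
proof -
  let ?m = "N + k" and ?x = "product_coordinates N x"
  have W_sub: "W \<subseteq> points Y"
    using openin_subset[OF W] .
  from W Y obtain h where h: "h \<in> polynomials N" "W = {p \<in> points Y. h (x p) \<noteq> 0}"
    by (auto simp: openin_affine)
  have hm: "h \<in> polynomials ?m"
    using polynomials_subst[OF h(1), of "\<lambda>z. z" ?m] by (simp add: polynomials_var)
  have "\<forall>j\<in>{..<N}. \<exists>PQ. fst PQ \<in> polynomials ?m \<and> snd PQ \<in> polynomials ?m \<and>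
      (\<forall>z\<in>W \<times> Rn k. snd PQ (?x z) \<noteq> 0 \<and> x (\<sigma> z) j = fst PQ (?x z) / snd PQ (?x z))"
  proof
    fix j assume "j \<in> {..<N}"
    then have "fraction_on ?m ?x (W \<times> Rn k) (\<lambda>z. x (\<sigma> z) j)"
      using \<sigma> by (simp add: spray_over_def)
    then obtain P Q where "P \<in> polynomials ?m" "Q \<in> polynomials ?m"
      "\<forall>z\<in>W \<times> Rn k. Q (?x z) \<noteq> 0 \<and> x (\<sigma> z) j = P (?x z) / Q (?x z)"
      unfolding fraction_on_def by (elim bexE)
    then show "\<exists>PQ. fst PQ \<in> polynomials ?m \<and> snd PQ \<in> polynomials ?m \<and>
      (\<forall>z\<in>W \<times> Rn k. snd PQ (?x z) \<noteq> 0 \<and> x (\<sigma> z) j = fst PQ (?x z) / snd PQ (?x z))"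
      by (intro exI[of _ "(P, Q)"]) simp
  qed
  from bchoice[OF this] obtain PQ where PQ: "\<forall>j\<in>{..<N}. fst (PQ j) \<in> polynomials ?m \<and> snd (PQ j) \<in> polynomials ?m \<and>
      (\<forall>z\<in>W \<times> Rn k. snd (PQ j) (?x z) \<noteq> 0 \<and> x (\<sigma> z) j = fst (PQ j) (?x z) / snd (PQ j) (?x z))" ..
  define P where "P j = fst (PQ j)" for j
  define Q where "Q j = snd (PQ j)" for j
  have poly: "P j \<in> polynomials ?m" "Q j \<in> polynomials ?m" if "j < N" for j
    using PQ that by (auto simp: P_def Q_def)
  have Q_nz: "Q j (?x z) \<noteq> 0" and \<sigma>_eq: "x (\<sigma> z) j = P j (?x z) / Q j (?x z)"
    if "j < N" "z \<in> W \<times> Rn k" for j z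
    using PQ that by (auto simp: P_def Q_def)
  \<comment> \<open>\<open>scale_fibre N 0\<close> makes these polynomials independent of the fibre coordinates\<close>
  define r where "r z = h (scale_fibre N 0 z) * (\<Prod>i<N. Q i (scale_fibre N 0 z))" for z
  define e where "e j z = h (scale_fibre N 0 z) * (\<Prod>i\<in>{..<N} - {j}. Q i (scale_fibre N 0 z))" for j z
  have scale_poly: "(\<lambda>z. F (scale_fibre N 0 z)) \<in> polynomials ?m" if "F \<in> polynomials ?m" for F
    using polynomials_scale_fibre[OF that polynomials_const[of 0]] .
  have r_poly: "r \<in> polynomials ?m"
    unfolding r_def[abs_def] by (intro polynomials_mult polynomials_prod scale_poly hm) (simp add: poly)
  have e_poly: "e j \<in> polynomials ?m" for j
    unfolding e_def[abs_def] by (intro polynomials_mult polynomials_prod scale_poly hm) (simp add: poly)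
  have r_e: "r z = Q j (scale_fibre N 0 z) * e j z" if "j < N" for j z
    using prod.remove[of "{..<N}" j "\<lambda>i. Q i (scale_fibre N 0 z)"] that by (simp add: r_def e_def)
  have h_eq: "h (scale_fibre N 0 (?x (y, v))) = h (x y)" for y v
    by (rule polynomials_cong[OF h(1)]) (simp add: scale_fibre_def product_coordinates_def join_def)
  define \<rho> where "\<rho> y = r (?x (y, \<lambda>_. 0))" for y
  have r_eq: "r (?x (y, v)) = \<rho> y" for y v
    unfolding r_def \<rho>_def scale_fibre_product_coordinates by simp
  have \<rho>_nz: "\<rho> y \<noteq> 0" if y: "y \<in> W" for y
  proof -
    have "Q i (scale_fibre N 0 (?x (y, \<lambda>_. 0))) \<noteq> 0" if "i < N" for i
      using Q_nz[OF that, of "(y, \<lambda>_. 0)"] y by (simp add: scale_fibre_product_coordinates zero_in_Rn)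
    moreover have "h (x y) \<noteq> 0"
      using y h(2) by simp
    ultimately show ?thesis
      unfolding \<rho>_def r_def h_eq by simp
  qed
  have e_zero: "e j (?x (y, v)) = 0" if "y \<in> points Y - W" for j y v
    using that h(2) by (simp add: e_def h_eq)
  define s where "s = (\<lambda>(y, v). if y \<in> W then \<sigma> (y, \<lambda>i. \<rho> y * v i) else y)"
  have "fraction_on ?m ?x (points Y \<times> Rn k) (\<lambda>z. x (s z) j)" if j: "j < N" for j
  proof -
    let ?M = "\<lambda>z. P j z - z j * Q j z"
    have M: "?M \<in> polynomials ?m"
      using poly[OF j] j by (intro polynomials_intros) auto
    from polynomial_scale_fibre_expansion[OF poly(2)[OF j] r_poly] obtain G where
      G: "G \<in> polynomials ?m" "\<forall>z. Q j (scale_fibre N (r z) z) = Q j (scale_fibre N 0 z) + r z * G z" ..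
    from polynomial_scale_fibre_expansion[OF M r_poly] obtain H where
      H: "H \<in> polynomials ?m" "\<forall>z. ?M (scale_fibre N (r z) z) = ?M (scale_fibre N 0 z) + r z * H z" ..
    show ?thesis
    proof (rule fraction_onI)
      show "(\<lambda>z. z j * (1 + e j z * G z) + e j z * H z) \<in> polynomials ?m"
        using j G(1) H(1) e_poly by (intro polynomials_intros) auto
      show "(\<lambda>z. 1 + e j z * G z) \<in> polynomials ?m"
        using G(1) e_poly by (intro polynomials_intros) auto
      fix z assume "z \<in> points Y \<times> Rn k"
      then obtain y v where z: "z = (y, v)" and y: "y \<in> points Y" and v: "v \<in> Rn k"
        by auto
      let ?z = "?x (y, v)"
      have zj: "?z j = x y j"
        using j by (simp add: product_coordinates_def join_def)
      show "1 + e j (?x z) * G (?x z) \<noteq> 0 \<and>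
          x (s z) j = (?x z j * (1 + e j (?x z) * G (?x z)) + e j (?x z) * H (?x z)) / (1 + e j (?x z) * G (?x z))"
      proof (cases "y \<in> W")
        case False
        then have "e j ?z = 0"
          using e_zero y by simp
        then show ?thesis
          using False zj by (simp add: z s_def)
      next
        case True
        let ?v = "\<lambda>i. \<rho> y * v i" and ?q = "Q j (?x (y, \<lambda>_. 0))"
        have at: "(y, ?v) \<in> W \<times> Rn k" "(y, \<lambda>_. 0) \<in> W \<times> Rn k"
          using True scale_in_Rn[OF v] zero_in_Rn by auto
        have scale: "scale_fibre N (r ?z) ?z = ?x (y, ?v)" "scale_fibre N 0 ?z = ?x (y, \<lambda>_. 0)"
          by (simp_all add: scale_fibre_product_coordinates r_eq)
        have coord: "?x (y, u) j = x y j" for u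
          using j by (simp add: product_coordinates_def join_def)
        have re: "r ?z = ?q * e j ?z"
          unfolding r_e[OF j] scale(2) ..
        have q: "?q \<noteq> 0"
          by (rule Q_nz[OF j at(2)])
        have "\<sigma> (y, \<lambda>_. 0) = y"
          using \<sigma> True by (simp add: spray_over_def)
        then have P0: "P j (?x (y, \<lambda>_. 0)) = x y j * ?q"
          using \<sigma>_eq[OF j at(2)] q by simp
        have Qv: "Q j (?x (y, ?v)) = ?q * (1 + e j ?z * G ?z)"
          using G(2)[rule_format, of ?z] unfolding scale unfolding re by (simp add: algebra_simps)
        have Pv: "P j (?x (y, ?v)) - x y j * Q j (?x (y, ?v)) = ?q * (e j ?z * H ?z)"
          using H(2)[rule_format, of ?z] unfolding scale unfolding re coord P0 by (simp add: algebra_simps)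
        have nz: "1 + e j ?z * G ?z \<noteq> 0"
          using Q_nz[OF j at(1)] unfolding Qv by auto
        have "P j (?x (y, ?v)) = ?q * (x y j * (1 + e j ?z * G ?z) + e j ?z * H ?z)"
          using Pv unfolding Qv by (simp add: algebra_simps)
        then have "x (\<sigma> (y, ?v)) j = (x y j * (1 + e j ?z * G ?z) + e j ?z * H ?z) / (1 + e j ?z * G ?z)"
          unfolding \<sigma>_eq[OF j at(1)] Qv using q by simp
        then show ?thesis
          using nz True zj by (simp add: z s_def)
      qed
    qed
  qed
  moreover have "s z \<in> points Y" if "z \<in> points Y \<times> Rn k" for z
    using that \<sigma> scale_in_Rn by (auto simp: s_def spray_over_def)
  moreover have "s (y, \<lambda>_. 0) = y" for y
    using \<sigma> by (simp add: s_def spray_over_def)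
  ultimately have "spray_over Y N x (points Y) k s"
    unfolding spray_over_def by blast
  moreover have "dominating_at Y N x k s y" if y: "y \<in> W" and dom: "dominating_at Y N x k \<sigma> y" for y
    unfolding dominating_at_def
  proof (intro allI impI)
    fix D assume "tangent_vector Y y D"
    with dom obtain w where w: "w \<in> Rn k"
      "\<forall>j<N. ((\<lambda>t. x (\<sigma> (y, \<lambda>i. t * w i)) j) has_real_derivative D (\<lambda>p. x p j)) (at 0)"
      unfolding dominating_at_def by blast
    \<comment> \<open>rescaling the direction compensates for the factor \<open>\<rho>\<close>\<close>
    have "s (y, \<lambda>i. t * (1 / \<rho> y * w i)) = \<sigma> (y, \<lambda>i. t * w i)" for t
      using \<rho>_nz[OF y] y by (simp add: s_def)
    then show "\<exists>w\<in>Rn k. \<forall>j<N.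
        ((\<lambda>t. x (s (y, \<lambda>i. t * w i)) j) has_real_derivative D (\<lambda>p. x p j)) (at 0)"
      using w(2) by (intro bexI[OF _ scale_in_Rn[OF w(1), of "1 / \<rho> y"]]) simp
  qed
  ultimately show thesis
    by (rule that)
qed

section \<open>Local sprays from malleable open subvarieties\<close>

lemma points_sub_bundle:
  assumes "affine_coordinates Y N x"
  shows "points (total_space (sub_bundle Y n E)) = (points Y \<times> Rn n) \<inter> E"
  by (simp add: sub_bundle_def points_induced_space affine_coordinates_product(1)[OF assms])

lemma affine_coordinates_sub_bundle:
  assumes "affine_coordinates Y N x"
  shows "affine_coordinates (total_space (sub_bundle Y n E)) (N + n) (product_coordinates N x)"
  using affine_coordinates_induced[OF affine_coordinates_product(2)[OF assms]]
  by (simp add: sub_bundle_def)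

text \<open>
  In a fibre the zero vector is the only one with \<open>e + e = e\<close>.
\<close>

lemma bundle_iso_zero:
  assumes iso: "bundle_iso Y B (sub_bundle Y n E) \<theta>" and y: "y \<in> points Y"
    and e: "e \<in> fibre B y" "vadd B e e = e"
  shows "\<theta> e = (y, \<lambda>_. 0)"
proof -
  have "fst (\<theta> e) = proj B e"
    using iso e(1) by (auto simp: bundle_iso_def fibre_def sub_bundle_def)
  then have "fst (\<theta> e) = y"
    using e(1) by (simp add: fibre_def)
  then obtain u where u: "\<theta> e = (y, u)"
    by (cases "\<theta> e") auto
  have "\<theta> (vadd B e e) = vadd (sub_bundle Y n E) (\<theta> e) (\<theta> e)"
    using iso y e(1) unfolding bundle_iso_def by blast
  then have "u = (\<lambda>i. u i + u i)"
    by (simp add: e(2) u sub_bundle_def)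
  then have "u i = 0" for i
    by (metis add_cancel_right_right)
  then show ?thesis
    using u by auto
qed

text \<open>
  Over a set \<open>W\<close> that trivializes the bundle of the given spray, composing the trivialization with the
  spray gives a spray on a product bundle with values in \<open>Y\<close>. A tangent vector of the original fibre is
  transported to a direction \<open>w\<close> in \<open>\<real>\<^sup>k\<close> by evaluating it on the fibre coordinates of the
  trivialization.
\<close>

lemma local_spray:
  assumes Y: "affine_coordinates Y N x" and U: "openin (zariski Y) U"
    and mall: "malleable (induced_space Y U)" and y0: "y0 \<in> U"
  obtains W k \<sigma> where "openin (zariski Y) W" "y0 \<in> W" "spray_over Y N x W k \<sigma>"
    "\<And>y. y \<in> W \<Longrightarrow> dominating_at Y N x k \<sigma> y"
proof -
  let ?U = "induced_space Y U" and ?pc = "product_coordinates N x"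
  have U_sub: "U \<subseteq> points Y"
    using openin_subset[OF U] .
  have pts_U: "points ?U = U"
    using U_sub by (auto simp: points_induced_space)
  have aff_U: "affine_coordinates ?U N x"
    by (rule affine_coordinates_induced[OF Y])
  from mall obtain B :: "('a \<times> (nat \<Rightarrow> real), 'a) vbundle" and s
    where spray: "spray ?U B s" and dom: "dominating ?U B s"
    unfolding malleable_def by auto
  from spray have alg: "algebraic_vector_bundle ?U B" and s_map: "regular_map (total_space B) ?U s"
    and s_zero: "\<And>y. y \<in> U \<Longrightarrow> s (vzero B y) = y"
    unfolding spray_def pts_U by auto
  from alg have family: "vector_space_family ?U B"
    by (simp add: algebraic_vector_bundle_def)
  from alg obtain n E \<theta>1 where sub: "algebraic_subbundle ?U n E"
    and iso1: "bundle_iso ?U B (sub_bundle ?U n E) \<theta>1"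
    unfolding algebraic_vector_bundle_def by auto
  from sub y0 obtain W k \<theta>2 where W: "openin (zariski ?U) W" "y0 \<in> W"
    and iso2: "bundle_iso (induced_space ?U W) (product_bundle (induced_space ?U W) k)
      (sub_bundle (induced_space ?U W) n (E \<inter> (W \<times> Rn n))) \<theta>2"
    unfolding algebraic_subbundle_def pts_U by blast
  have W_Y: "openin (zariski Y) W" and W_U: "W \<subseteq> U"
    using W(1) openin_open_subtopology[OF U] by (auto simp: induced_space_def)
  let ?W = "induced_space ?U W"
  have pts_W: "points ?W = W"
    using W_U pts_U by (auto simp: points_induced_space)
  have aff_W: "affine_coordinates ?W N x"
    by (rule affine_coordinates_induced[OF aff_U])
  define T where "T = total_space (product_bundle ?W k)"
  define M where "M = total_space (sub_bundle ?W n (E \<inter> (W \<times> Rn n)))"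
  define E1 where "E1 = total_space (sub_bundle ?U n E)"
  have aff_T: "affine_coordinates T (N + k) ?pc" and aff_M: "affine_coordinates M (N + n) ?pc"
    and aff_E1: "affine_coordinates E1 (N + n) ?pc"
    unfolding T_def M_def E1_def
    by (rule affine_coordinates_sub_bundle[OF aff_W] affine_coordinates_sub_bundle[OF aff_U])+
  have pts_T: "points T = W \<times> Rn k"
    unfolding T_def points_sub_bundle[OF aff_W] pts_W by auto
  have pts_M: "points M = E \<inter> (W \<times> Rn n)"
    unfolding M_def points_sub_bundle[OF aff_W] pts_W by auto
  have pts_E1: "points E1 = E \<inter> (U \<times> Rn n)"
    unfolding E1_def points_sub_bundle[OF aff_U] pts_U by auto
  have ring1: "ringed_iso (total_space B) E1 \<theta>1" and ring2: "ringed_iso T M \<theta>2"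
    using iso1 iso2 unfolding bundle_iso_def T_def M_def E1_def by auto
  obtain \<psi>1 where \<theta>1: "regular_map (total_space B) E1 \<theta>1" and \<psi>1: "regular_map E1 (total_space B) \<psi>1"
    and inv1: "\<And>e. e \<in> points (total_space B) \<Longrightarrow> \<psi>1 (\<theta>1 e) = e"
    using ringed_iso_regular_maps[OF ring1 aff_E1] by metis
  obtain \<psi>2 where \<theta>2: "regular_map T M \<theta>2" and \<psi>2: "regular_map M T \<psi>2"
    and inv2: "\<And>p. p \<in> points T \<Longrightarrow> \<psi>2 (\<theta>2 p) = p" "\<And>q. q \<in> points M \<Longrightarrow> \<theta>2 (\<psi>2 q) = q"
    using ringed_iso_regular_maps[OF ring2 aff_M] by metis
  have aff_B: "affine_coordinates (total_space B) (N + n) (?pc \<circ> \<theta>1)"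
    by (rule affine_coordinates_iso[OF ring1 aff_E1])
  \<comment> \<open>same coordinates, larger base\<close>
  have incl: "regular_map M E1 (\<lambda>q. q)"
  proof (rule regular_mapI[OF aff_M aff_E1])
    show "q \<in> points E1" if "q \<in> points M" for q
      using that W_U by (auto simp: pts_M pts_E1)
  qed (rule fraction_on_coordinate)
  define \<sigma> where "\<sigma> = (\<lambda>p. s (\<psi>1 (\<theta>2 p)))"
  have "regular_map T ?U (s \<circ> (\<psi>1 \<circ> ((\<lambda>q. q) \<circ> \<theta>2)))"
    by (rule regular_map_compose[OF regular_map_compose[OF regular_map_compose[OF \<theta>2 incl] \<psi>1] s_map])
  then have \<sigma>_map: "regular_map T ?U \<sigma>"
    by (simp add: \<sigma>_def comp_def)
  have proj2: "fst (\<theta>2 p) = fst p" if "p \<in> points T" for p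
    using iso2 that by (auto simp: bundle_iso_def T_def sub_bundle_def)
  have \<theta>2_zero: "\<theta>2 (y, \<lambda>_. 0) = (y, \<lambda>_. 0)" if y: "y \<in> W" for y
  proof (rule bundle_iso_zero[OF iso2])
    show "y \<in> points ?W"
      using y pts_W by simp
    show "(y, \<lambda>_. 0) \<in> fibre (product_bundle ?W k) y"
      using y zero_in_Rn pts_T[unfolded T_def] by (simp add: fibre_def sub_bundle_def)
  qed (simp add: sub_bundle_def)
  have zero: "vzero B y \<in> fibre B y" "\<theta>1 (vzero B y) = (y, \<lambda>_. 0)" if y: "y \<in> U" for y
  proof -
    have vs: "real_vector_space_on (fibre B y) (vadd B) (vscale B) (vzero B y)"
      using family y unfolding vector_space_family_def pts_U by blast
    show z: "vzero B y \<in> fibre B y"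
      using vs by (simp add: real_vector_space_on_def)
    have "vadd B (vzero B y) (vzero B y) = vzero B y"
      using vs z by (simp add: real_vector_space_on_def)
    then show "\<theta>1 (vzero B y) = (y, \<lambda>_. 0)"
      using y pts_U by (intro bundle_iso_zero[OF iso1 _ z]) simp_all
  qed
  have \<sigma>_zero: "\<sigma> (y, \<lambda>_. 0) = y" if y: "y \<in> W" for y
  proof -
    have yU: "y \<in> U"
      using y W_U by auto
    have "\<psi>1 (y, \<lambda>_. 0) = vzero B y"
      using inv1[of "vzero B y"] zero[OF yU] by (simp add: fibre_def)
    then show ?thesis
      by (simp add: \<sigma>_def \<theta>2_zero[OF y] s_zero[OF yU])
  qed
  have \<sigma>_fraction: "fraction_on (N + k) ?pc (W \<times> Rn k) (\<lambda>z. x (\<sigma> z) j)" if "j < N" for j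
    using regular_map_coordinate[OF aff_T aff_U \<sigma>_map that] by (simp add: pts_T)
  have "\<sigma> z \<in> points Y" if "z \<in> W \<times> Rn k" for z
    using regular_map_points[OF \<sigma>_map, of z] that pts_T pts_U U_sub by auto
  then have "spray_over Y N x W k \<sigma>"
    unfolding spray_over_def using \<sigma>_fraction \<sigma>_zero by blast
  moreover have "dominating_at Y N x k \<sigma> y" if y: "y \<in> W" for y
    unfolding dominating_at_def
  proof (intro allI impI)
    fix D' assume D': "tangent_vector Y y D'"
    have yU: "y \<in> U"
      using y W_U by auto
    define F where "F = induced_space (total_space B) (fibre B y)"
    define e0 where "e0 = vzero B y"
    have pts_F: "points F = fibre B y"
      unfolding F_def points_induced_space by (auto simp: fibre_def)
    have aff_F: "affine_coordinates F (N + n) (?pc \<circ> \<theta>1)"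
      unfolding F_def by (rule affine_coordinates_induced[OF aff_B])
    have e0: "e0 \<in> points F"
      using zero(1)[OF yU] by (simp add: pts_F e0_def)
    have F_B: "e \<in> points (total_space B)" "fst (\<theta>1 e) = y" "\<theta>1 e \<in> points M" if "e \<in> points F" for e
    proof -
      show e: "e \<in> points (total_space B)"
        using that by (simp add: pts_F fibre_def)
      have "fst (\<theta>1 e) = proj B e"
        using iso1 e by (auto simp: bundle_iso_def sub_bundle_def)
      then show fst: "fst (\<theta>1 e) = y"
        using that by (simp add: pts_F fibre_def)
      have "\<theta>1 e \<in> points E1"
        by (rule regular_map_points[OF \<theta>1 e])
      then show "\<theta>1 e \<in> points M"
        using fst y by (cases "\<theta>1 e") (auto simp: pts_M pts_E1)
    qed
    have "submersion_at F ?U s e0"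
      using dom yU unfolding dominating_def pts_U F_def e0_def by blast
    moreover have s_e0: "s e0 = y"
      using s_zero[OF yU] by (simp add: e0_def)
    moreover have "tangent_vector ?U y D'"
      by (rule tangent_vector_induced_open[OF Y U D'])
    ultimately obtain D where D: "tangent_vector F e0 D"
      and D_eq: "\<And>g. g \<in> regular_at ?U y \<Longrightarrow> D' g = D (g \<circ> s)"
      unfolding submersion_at_def by auto
    have \<theta>1_F: "regular_map F M \<theta>1"
    proof (rule regular_mapI[OF aff_F aff_M])
      fix j assume "j < N + n"
      from fraction_on_coordinate[OF this, of "?pc \<circ> \<theta>1" "points F"] show "fraction_on (N + n) (?pc \<circ> \<theta>1) (points F) (\<lambda>e. ?pc (\<theta>1 e) j)"
        by simp
    qed (rule F_B(3))
    \<comment> \<open>the fibre of the original bundle in terms of the trivialization\<close>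
    define \<zeta> where "\<zeta> = (\<lambda>e. \<psi>2 (\<theta>1 e))"
    have \<zeta>_map: "regular_map F T \<zeta>"
      using regular_map_compose[OF \<theta>1_F \<psi>2] by (simp add: \<zeta>_def comp_def)
    have \<zeta>: "\<theta>2 (\<zeta> e) = \<theta>1 e" "\<zeta> e \<in> points T" "fst (\<zeta> e) = y" if "e \<in> points F" for e
    proof -
      show eq: "\<theta>2 (\<zeta> e) = \<theta>1 e"
        unfolding \<zeta>_def by (rule inv2(2)[OF F_B(3)[OF that]])
      show T: "\<zeta> e \<in> points T"
        by (rule regular_map_points[OF \<zeta>_map that])
      show "fst (\<zeta> e) = y"
        using proj2[OF T] eq F_B(2)[OF that] by simp
    qed
    have \<zeta>_e0: "\<zeta> e0 = (y, \<lambda>_. 0)"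
    proof -
      have "(y, \<lambda>_. 0) \<in> points T"
        using y zero_in_Rn by (simp add: pts_T)
      from inv2(1)[OF this] show ?thesis
        by (simp add: \<zeta>_def e0_def zero(2)[OF yU] \<theta>2_zero[OF y])
    qed
    define c where "c = (\<lambda>e. ?pc (\<zeta> e))"
    have c_reg: "(\<lambda>e. c e i) \<in> regular_at F e0" if "i < N + k" for i
      unfolding c_def
      by (rule regular_atI[OF aff_F e0 regular_map_coordinate[OF aff_F aff_T \<zeta>_map that]])
    define w where "w = (\<lambda>i. if i < k then D (\<lambda>e. snd (\<zeta> e) i) else 0)"
    have w: "w \<in> Rn k"
      by (simp add: Rn_def w_def)
    define \<gamma> where "\<gamma> = (\<lambda>t::real. ?pc (y, \<lambda>i. t * w i))"
    have \<gamma>_0: "\<gamma> 0 i = c e0 i" for i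
      by (simp add: \<gamma>_def c_def \<zeta>_e0)
    have \<gamma>_deriv: "((\<lambda>t. \<gamma> t i) has_real_derivative D (\<lambda>e. c e i)) (at 0)" if i: "i < N + k" for i
    proof (cases "i < N")
      case True
      have "c e i = x y i" if "e \<in> points F" for e
        using \<zeta>(3)[OF that] True by (cases "\<zeta> e") (simp add: c_def product_coordinates_def join_def)
      then have "germ_eq F e0 (\<lambda>e. c e i) (\<lambda>_. x y i)"
        unfolding germ_eq_def using e0 by (intro exI[of _ "points F"]) simp
      then have "D (\<lambda>e. c e i) = D (\<lambda>_. x y i)"
        by (rule tangent_vectorD(1)[OF D c_reg[OF i] regular_atI[OF aff_F e0 fraction_on_const]])
      also have "\<dots> = 0"
        by (rule tangent_vector_const[OF aff_F e0 D])
      finally show ?thesis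
        using True by (simp add: \<gamma>_def product_coordinates_def join_def)
    next
      case False
      then have "(\<lambda>e. c e i) = (\<lambda>e. snd (\<zeta> e) (i - N))"
        by (auto simp: c_def product_coordinates_def join_def split: prod.splits)
      then have "D (\<lambda>e. c e i) = w (i - N)"
        using False i by (simp add: w_def)
      moreover have "(\<lambda>t. \<gamma> t i) = (\<lambda>t. t * w (i - N))"
        using False by (simp add: \<gamma>_def product_coordinates_def join_def)
      ultimately show ?thesis
        by (auto intro!: derivative_eq_intros)
    qed
    have "((\<lambda>t. x (\<sigma> (y, \<lambda>i. t * w i)) j) has_real_derivative D' (\<lambda>p. x p j)) (at 0)" if j: "j < N" for j
    proof -
      from \<sigma>_fraction[OF j] obtain P Q where PQ: "P \<in> polynomials (N + k)" "Q \<in> polynomials (N + k)"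
        "\<forall>z\<in>W \<times> Rn k. Q (?pc z) \<noteq> 0 \<and> x (\<sigma> z) j = P (?pc z) / Q (?pc z)"
        unfolding fraction_on_def by (elim bexE)
      define g where "g = (\<lambda>e. x (s e) j)"
      have "fraction_on (N + n) (?pc \<circ> \<theta>1) (points (total_space B)) g"
        unfolding g_def by (rule regular_map_coordinate[OF aff_B aff_U s_map j])
      then have "fraction_on (N + n) (?pc \<circ> \<theta>1) (points F) g"
        by (rule fraction_on_subset) (use F_B(1) in auto)
      then have g: "g \<in> regular_at F e0"
        by (rule regular_atI[OF aff_F e0])
      have g_eq: "Q (c e) \<noteq> 0 \<and> g e = P (c e) / Q (c e)" if e: "e \<in> points F" for e
      proof -
        have "\<sigma> (\<zeta> e) = s e"
          by (simp add: \<sigma>_def \<zeta>(1)[OF e] inv1[OF F_B(1)[OF e]])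
        then show ?thesis
          using PQ(3) \<zeta>(2)[OF e] unfolding pts_T c_def g_def by metis
      qed
      have "((\<lambda>t. P (\<gamma> t) / Q (\<gamma> t)) has_real_derivative D g) (at 0)"
        by (rule tangent_vector_fraction[where m = "N + k" and c = c and \<gamma> = \<gamma>,
              OF aff_F e0 D c_reg \<gamma>_0 \<gamma>_deriv PQ(1,2) g openin_topspace e0])
          (use g_eq in auto)
      moreover have "P (\<gamma> t) / Q (\<gamma> t) = x (\<sigma> (y, \<lambda>i. t * w i)) j" for t
        using PQ(3) y scale_in_Rn[OF w] by (simp add: \<gamma>_def)
      moreover have "D' (\<lambda>p. x p j) = D g"
      proof -
        have "(\<lambda>p. x p j) \<in> regular_at ?U y"
          by (rule regular_atI[OF aff_U _ fraction_on_coordinate[OF j]]) (use yU pts_U in simp)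
        from D_eq[OF this] show ?thesis
          by (simp add: g_def comp_def)
      qed
      ultimately show ?thesis
        by simp
    qed
    with w show "\<exists>w\<in>Rn k. \<forall>j<N.
        ((\<lambda>t. x (\<sigma> (y, \<lambda>i. t * w i)) j) has_real_derivative D' (\<lambda>p. x p j)) (at 0)"
      by (intro bexI[of _ w] allI impI)
  qed
  ultimately show thesis
    by (rule that[OF W_Y W(2)])
qed

section \<open>Malleability is a local property\<close>

text \<open>
  Each local spray extends to a global one that still dominates on the original open set. Finitely many
  of these open sets cover \<open>Y\<close>, and the composite of the corresponding sprays dominates everywhere.
\<close>

lemma global_spray:
  assumes Y: "affine_coordinates Y N x"
    and locally: "\<forall>y\<in>points Y.
      \<exists>W k \<sigma>. openin (zariski Y) W \<and> y \<in> W \<and> spray_over Y N x W k \<sigma> \<and> (\<forall>z\<in>W. dominating_at Y N x k \<sigma> z)"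
  shows "\<exists>k s. spray_over Y N x (points Y) k s \<and> (\<forall>y\<in>points Y. dominating_at Y N x k s y)"
proof -
  define F where "F = {P \<in> polynomials N. \<exists>k s. spray_over Y N x (points Y) k s \<and>
      (\<forall>y\<in>points Y. P (x y) \<noteq> 0 \<longrightarrow> dominating_at Y N x k s y)}"
  have "F \<subseteq> polynomials N"
    by (auto simp: F_def)
  from finite_zero_locus[OF this] obtain F' where
    F': "finite F' \<and> F' \<subseteq> F \<and> (\<forall>z. (\<forall>P\<in>F'. P z = 0) \<longrightarrow> (\<forall>P\<in>F. P z = 0))" ..
  have "\<exists>k s. spray_over Y N x (points Y) k s \<and>
      (\<forall>y\<in>points Y. (\<exists>P\<in>G. P (x y) \<noteq> 0) \<longrightarrow> dominating_at Y N x k s y)" if "finite G" "G \<subseteq> F" for G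
    using that
  proof (induction rule: finite_induct)
    case empty
    have "fraction_on (N + 0) (product_coordinates N x) (points Y \<times> Rn 0) (\<lambda>z. x (fst z) j)" if "j < N" for j
      by (rule fraction_on_base[OF fraction_on_coordinate[OF that, of x "points Y"]]) auto
    then have "spray_over Y N x (points Y) 0 fst"
      by (auto simp: spray_over_def)
    then show ?case
      by blast
  next
    case (insert P G)
    then obtain a s1 where s1: "spray_over Y N x (points Y) a s1"
      "\<forall>y\<in>points Y. (\<exists>P\<in>G. P (x y) \<noteq> 0) \<longrightarrow> dominating_at Y N x a s1 y"
      by auto
    from insert.prems obtain b s2 where s2: "spray_over Y N x (points Y) b s2"
      "\<forall>y\<in>points Y. P (x y) \<noteq> 0 \<longrightarrow> dominating_at Y N x b s2 y"
      by (auto simp: F_def)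
    obtain s where s: "spray_over Y N x (points Y) (a + b) s"
      "\<And>y. y \<in> points Y \<Longrightarrow> dominating_at Y N x a s1 y \<or> dominating_at Y N x b s2 y \<Longrightarrow>
        dominating_at Y N x (a + b) s y"
      using spray_over_compose[OF s1(1) s2(1)] by blast
    show ?case
      using s s1(2) s2(2) by (intro exI[of _ "a + b"] exI[of _ s]) auto
  qed
  from this[OF F'[THEN conjunct1] F'[THEN conjunct2, THEN conjunct1]] obtain k s where
    s: "spray_over Y N x (points Y) k s"
    "\<forall>y\<in>points Y. (\<exists>P\<in>F'. P (x y) \<noteq> 0) \<longrightarrow> dominating_at Y N x k s y"
    by (elim exE conjE)
  have "\<exists>P\<in>F'. P (x y) \<noteq> 0" if y: "y \<in> points Y" for y
  proof -
    from bspec[OF locally y] obtain W k \<sigma> where W: "openin (zariski Y) W" "y \<in> W" "spray_over Y N x W k \<sigma>"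
      "\<forall>z\<in>W. dominating_at Y N x k \<sigma> z"
      by auto
    from W(1) Y obtain P where P: "P \<in> polynomials N" "W = {q \<in> points Y. P (x q) \<noteq> 0}"
      by (auto simp: openin_affine)
    obtain s where "spray_over Y N x (points Y) k s"
      "\<And>z. z \<in> W \<Longrightarrow> dominating_at Y N x k \<sigma> z \<Longrightarrow> dominating_at Y N x k s z"
      using spray_over_extend[OF Y W(1,3)] by blast
    then have "P \<in> F"
      using P W(4) by (auto simp: F_def)
    then show ?thesis
      using F' W(2) P(2) by blast
  qed
  with s show ?thesis
    by (intro exI[of _ k] exI[of _ s]) simp
qed

lemma sub_bundle_simps:
  "proj (sub_bundle Y k E) = fst"
  "vadd (sub_bundle Y k E) (y, u) (z, v) = (y, \<lambda>i. u i + v i)"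
  "vscale (sub_bundle Y k E) c (y, u) = (y, \<lambda>i. c * u i)"
  "vzero (sub_bundle Y k E) y = (y, \<lambda>_. 0)"
  by (simp_all add: sub_bundle_def)

lemma bundle_iso_id: "bundle_iso Y B B id"
  by (simp add: bundle_iso_def ringed_iso_def) (rule exI[of _ id], simp add: homeomorphic_maps_id)

lemma product_bundle_algebraic:
  assumes Y: "affine_coordinates Y N x"
  shows "algebraic_vector_bundle Y (product_bundle Y k)"
proof -
  let ?B = "product_bundle Y k"
  have pts: "points (total_space ?B) = points Y \<times> Rn k"
    by (simp add: points_sub_bundle[OF Y])
  have "fraction_on (N + k) (product_coordinates N x) (points Y \<times> Rn k) (\<lambda>z. x (fst z) j)" if "j < N" for j
    by (rule fraction_on_base[OF fraction_on_coordinate[OF that, of x "points Y"]]) auto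
  then have "regular_map (total_space ?B) Y (proj ?B)"
    by (intro regular_mapI[OF affine_coordinates_sub_bundle[OF Y] Y]) (auto simp: pts sub_bundle_simps)
  moreover have "real_vector_space_on (fibre ?B y) (vadd ?B) (vscale ?B) (vzero ?B y)" if "y \<in> points Y" for y
  proof -
    have "fibre ?B y = {y} \<times> Rn k"
      using that by (auto simp: fibre_def pts sub_bundle_simps)
    moreover have "\<exists>v\<in>Rn k. \<forall>i. u i + v i = 0" if "u \<in> Rn k" for u
      using that by (intro bexI[of _ "\<lambda>i. - u i"]) (auto simp: Rn_def)
    ultimately show ?thesis
      unfolding real_vector_space_on_def
      by (auto simp: sub_bundle_simps Rn_def algebra_simps fun_eq_iff)
  qed
  ultimately have family: "vector_space_family Y ?B"
    unfolding vector_space_family_def by blast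
  have "points (induced_space Y (points Y)) = points Y"
    by (simp add: points_induced_space)
  then have "algebraic_subbundle Y k (points Y \<times> Rn k)"
    unfolding algebraic_subbundle_def using family bundle_iso_id
    by (auto intro!: exI[of _ "points Y"] exI[of _ k] exI[of _ id])
  with family show ?thesis
    unfolding algebraic_vector_bundle_def using bundle_iso_id by blast
qed

text \<open>
  The direction \<open>w\<close> in the fibre \<open>{y} \<times> \<real>\<^sup>k\<close> defines a tangent vector, namely the directional derivative at
  the origin. Its image under the differential has the same values on the coordinates as the given
  tangent vector, hence equals it.
\<close>

lemma malleable_if_global_spray:
  assumes Y: "affine_coordinates Y N x" and s: "spray_over Y N x (points Y) k s"
    and dom: "\<forall>y\<in>points Y. dominating_at Y N x k s y"
  shows "malleable Y"
proof -
  let ?B = "product_bundle Y k" and ?pc = "product_coordinates N x"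
  have pts: "points (total_space ?B) = points Y \<times> Rn k"
    by (simp add: points_sub_bundle[OF Y])
  have aff: "affine_coordinates (total_space ?B) (N + k) ?pc"
    by (rule affine_coordinates_sub_bundle[OF Y])
  have "regular_map (total_space ?B) Y s"
    using s by (intro regular_mapI[OF aff Y]) (auto simp: spray_over_def pts)
  then have "spray Y ?B s"
    unfolding spray_def using s product_bundle_algebraic[OF Y]
    by (auto simp: spray_over_def sub_bundle_simps)
  moreover have "dominating Y ?B s"
    unfolding dominating_def
  proof
    fix y assume y: "y \<in> points Y"
    define F where "F = induced_space (total_space ?B) (fibre ?B y)"
    have fibre: "fibre ?B y = {y} \<times> Rn k"
      using y by (auto simp: fibre_def pts sub_bundle_simps)
    have pts_F: "points F = {y} \<times> Rn k"
      using y by (auto simp: F_def points_induced_space fibre pts)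
    have aff_F: "affine_coordinates F (N + k) ?pc"
      unfolding F_def by (rule affine_coordinates_induced[OF aff])
    have "submersion_at F Y s (y, \<lambda>_. 0)"
      unfolding submersion_at_def
    proof (intro allI impI)
      have s_zero: "s (y, \<lambda>_. 0) = y"
        using s y by (simp add: spray_over_def)
      fix D' assume "tangent_vector Y (s (y, \<lambda>_. 0)) D'"
      then have D': "tangent_vector Y y D'"
        by (simp add: s_zero)
      with dom y obtain w where w: "w \<in> Rn k"
        "\<forall>j<N. ((\<lambda>t. x (s (y, \<lambda>i. t * w i)) j) has_real_derivative D' (\<lambda>p. x p j)) (at 0)"
        unfolding dominating_at_def by blast
      define l where "l t = (y, \<lambda>i. t * w i)" for t :: real
      have l_0: "l 0 = (y, \<lambda>_. 0)"
        by (simp add: l_def)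
      have l_F: "l t \<in> points F" for t
        using scale_in_Rn[OF w(1)] by (simp add: l_def pts_F)
      have l_deriv: "\<exists>d. ((\<lambda>t. ?pc (l t) i) has_real_derivative d) (at 0)" for i
      proof (cases "i < N")
        case True
        then show ?thesis
          by (auto simp: l_def product_coordinates_def join_def intro: DERIV_const)
      next
        case False
        then show ?thesis
          by (auto simp: l_def product_coordinates_def join_def intro!: exI[of _ "w (i - N)"] derivative_eq_intros)
      qed
      \<comment> \<open>only the values on germs of regular functions matter, and those are differentiable along the line\<close>
      define D where "D f = deriv (\<lambda>t. f (l t)) 0" for f
      have D: "((\<lambda>t. f (l t)) has_real_derivative D f) (at 0)" if "f \<in> regular_at F (l 0)" for f
        using regular_curve_differentiable[where c = l, OF aff_F that l_F l_deriv]
        unfolding D_def by (auto simp: DERIV_imp_deriv)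
      have D_eq: "D f = d" if "((\<lambda>t. f (l t)) has_real_derivative d) (at 0)" for f d
        unfolding D_def by (rule DERIV_imp_deriv[OF that])
      have "tangent_vector F (l 0) D"
        unfolding tangent_vector_def
      proof (intro conjI ballI impI allI)
        fix f g assume f: "f \<in> regular_at F (l 0)" and g: "g \<in> regular_at F (l 0)"
        show "D (\<lambda>z. f z + g z) = D f + D g"
          by (rule D_eq, rule DERIV_add[OF D[OF f] D[OF g]])
        show "D (\<lambda>z. f z * g z) = f (l 0) * D g + g (l 0) * D f"
          by (rule D_eq) (use DERIV_mult[OF D[OF f] D[OF g]] in \<open>simp add: ac_simps\<close>)
        assume "germ_eq F (l 0) f g"
        then obtain V where V: "openin (zariski F) V" "l 0 \<in> V" "\<forall>z\<in>V. f z = g z"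
          unfolding germ_eq_def by auto
        have "\<forall>\<^sub>F t in nhds 0. l t \<in> V"
          by (rule curve_eventually[where c = l, OF aff_F V(1,2) l_F l_deriv])
        then have "\<forall>\<^sub>F t in nhds 0. f (l t) = g (l t)"
          by (rule eventually_mono) (use V(3) in auto)
        with D[OF g] show "D f = D g"
          by (intro D_eq) (rule DERIV_eventually_eq)
      next
        fix f c assume f: "f \<in> regular_at F (l 0)"
        show "D (\<lambda>z. c * f z) = c * D f"
          by (rule D_eq, rule DERIV_cmult[OF D[OF f]])
      qed
      moreover have "D' g = D (g \<circ> s)" if g: "g \<in> regular_at Y y" for g
      proof -
        have "((\<lambda>t. g (s (l t))) has_real_derivative D' g) (at 0)"
        proof (rule regular_curve_derivative[where c = "\<lambda>t. s (l t)", OF Y])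
          show "tangent_vector Y (s (l 0)) D'" "g \<in> regular_at Y (s (l 0))"
            using D' g by (simp_all add: l_0 s_zero)
          show "s (l t) \<in> points Y" for t
            using s l_F[of t] y by (auto simp: spray_over_def pts_F)
        qed (use w(2) in \<open>simp add: l_def\<close>)
        then show ?thesis
          using D_eq[of "g \<circ> s"] by simp
      qed
      ultimately show "\<exists>D. tangent_vector F (y, \<lambda>_. 0) D \<and>
          (\<forall>g\<in>regular_at Y (s (y, \<lambda>_. 0)). D' g = D (g \<circ> s))"
        unfolding s_zero l_0 by blast
    qed
    then show "submersion_at (induced_space (total_space ?B) (fibre ?B y)) Y s (vzero ?B y)"
      by (simp add: F_def sub_bundle_simps)
  qed
  ultimately show ?thesis
    unfolding malleable_def by blast
qed

theorem theorem1p9: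
  fixes Y :: "'a ringed_space"
  assumes "real_algebraic_variety Y"
    and "nonsingular Y"
    and "\<And>y. y \<in> points Y \<Longrightarrow>
           \<exists>U. openin (zariski Y) U \<and> y \<in> U \<and> malleable (induced_space Y U)"
  shows "malleable Y"
proof -
  obtain N x where Y: "affine_coordinates Y N x"
    using variety_affine_coordinates[OF assms(1)] .
  have "\<forall>y\<in>points Y. \<exists>W k \<sigma>. openin (zariski Y) W \<and> y \<in> W \<and> spray_over Y N x W k \<sigma> \<and>
      (\<forall>z\<in>W. dominating_at Y N x k \<sigma> z)"
  proof
    fix y assume "y \<in> points Y"
    from assms(3)[OF this] obtain U where U: "openin (zariski Y) U" "y \<in> U" "malleable (induced_space Y U)"
      by auto
    show "\<exists>W k \<sigma>. openin (zariski Y) W \<and> y \<in> W \<and> spray_over Y N x W k \<sigma> \<and>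
        (\<forall>z\<in>W. dominating_at Y N x k \<sigma> z)"
      by (rule local_spray[OF Y U(1,3,2)]) blast
  qed
  from global_spray[OF Y this] obtain k s where
    "spray_over Y N x (points Y) k s" "\<forall>y\<in>points Y. dominating_at Y N x k s y"
    by (elim exE conjE)
  then show ?thesis
    by (rule malleable_if_global_spray[OF Y])
qed

end
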